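(* Let $T>0$ and $s>1/2$, and let $\mathcal{A}$ be a set of functions $f:[-T,T]\to H^s(\mathbb{R})$ satisfying conditions (i)–(iv) of the context, with constants $C_0,\tilde C_0>0$, $\tilde C_1\ge 0$, $\Theta>0$, $R>0$, $\gamma_1,\gamma_2\in(0,1)$ as described there. Then for each $\theta\in(0,1)$ there exists a positive constant $\rho=\rho(\theta)$ such that, for each $t\in[-T,T]$ and all $f\in\mathcal{A}$, $$\|f(t)\|_{L^2(d\dot\mu_\theta)}^2\le \|f(t)\|_{H^s}^{2\rho}\,\Big(K_0\,\|f(0)\|_{L^2}^2+K_1\,\|f(0)\|_{L^2(d\dot\mu_\theta)}^2+K_2\Big),$$ where $$K_0=C_0\,R^{2\theta}\Big(\frac4\Theta\Big)^{\rho+1},\qquad K_1=\frac{\tilde C_0}{\rho(1-\gamma_2)}\Big(\frac4\Theta\Big)^{\rho},\qquad K_2=\frac{\tilde C_1}{\rho R^{2\theta\rho}}.$$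
   Context: For $\theta\ge 0$, $d\dot\mu_\theta(\xi)=|\xi|^{2\theta}d\xi$ on $\mathbb{R}$, $d\dot\mu=d\dot\mu_1$, so $\|f\|_{L^2(d\dot\mu_\theta)}^2=\int_{\mathbb{R}}|f(\xi)|^2|\xi|^{2\theta}d\xi$. $H^s=H^s(\mathbb{R})$ has norm $\|f\|_{H^s}=\big(\int(1+|\xi|^2)^s|\widehat f(\xi)|^2d\xi\big)^{1/2}$. Write $f(t)=f(t,\cdot)$, and let $\mathcal{L}^1$ be Lebesgue measure on $\mathbb{R}$. The conditions on the functions $f\in\mathcal{A}$, for all $t\in[-T,T]$, are: (i) For each $t\in[-T,T]$, $\mathcal{L}^1(\{\xi\in\mathbb{R}: f(t,\xi)\neq 0\})>0$. (ii) There exist constants $C_0,\tilde C_0>0$, $\tilde C_1\ge0$ (independent of $f$ and $t$) such that $\|f(t)\|_{L^2}^2\le C_0\|f(0)\|_{L^2}^2$ and $\|f(t)\|_{L^2(d\dot\mu)}^2\le\tilde C_0\|f(0)\|_{L^2(d\dot\mu)}^2+\tilde C_1$. (iii) For all $\theta\in[0,1]$ there exist $\Theta>0$ (independent of $f$ and $t$) and $\gamma_1\in(0,1)$ such that $\int_{\{|f(t)|^2<\Theta\}}|f(t)|^2\,d\dot\mu_\theta\le\gamma_1\int_{\mathbb{R}}|f(t)|^2\,d\dot\mu_\theta$. (iv) There exist $R>0$ and $\gamma_2\in(0,1)$ (both independent of $f$) such that $\int_{\mathbb{R}\setminus(-R,R)}|f(0)|^2\,d\dot\mu\le\gamma_2\int_{\mathbb{R}}|f(0)|^2\,d\dot\mu$.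 In the claim, $\Theta$ is the constant given by (iii) for the value $\theta$ under consideration.
   Formalization: It is assumed in addition that f(0) belongs to L^2(dμ) for every f in A; if infinite L^2(dμ) norms were allowed, (ii) and (iv) could read ∞ ≤ ∞ and the claim would fail. *)

theory Defs
  imports "HOL-Analysis.Analysis"
begin

text \<open>The measure $|\xi|^{2\theta}\,d\xi$. For $\theta = 0$ the density vanishes at the single point
  $0$ (as $0$ powr $0 = 0$), which does not affect the measure: it is Lebesgue measure.\<close>

definition mu_dot :: "real \<Rightarrow> real measure" where
  "mu_dot \<theta> = density lborel (\<lambda>\<xi>. ennreal (\<bar>\<xi>\<bar> powr (2 * \<theta>)))"

text \<open>The squared norm of $L^2(M)$, with value $\infty$ outside $L^2(M)$.\<close>

definition L2_sq :: "real measure \<Rightarrow> (real \<Rightarrow> complex) \<Rightarrow> ennreal" where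
  "L2_sq M f = (\<integral>\<^sup>+ x. ennreal ((norm (f x))\<^sup>2) \<partial>M)"

definition L2 :: "(real \<Rightarrow> complex) set" where
  "L2 = {f \<in> borel_measurable borel. L2_sq lborel f < \<infinity>}"

text \<open>The Fourier transform on $L^2$, with the unitary normalisation: $\widehat f$ is the limit in
  $L^2$, as $r \to \infty$, of the integrals of $(2\pi)^{-1/2} f(x) e^{-ix\xi}$ over $[-r,r]$. It is
  determined up to null sets.\<close>

definition fourier_cutoff :: "(real \<Rightarrow> complex) \<Rightarrow> real \<Rightarrow> real \<Rightarrow> complex" where
  "fourier_cutoff f r \<xi> =
     complex_of_real (1 / sqrt (2 * pi)) * (LINT x:{-r..r}|lborel. f x * cis (- (x * \<xi>)))"

definition has_fourier_transform :: "(real \<Rightarrow> complex) \<Rightarrow> (real \<Rightarrow> complex) \<Rightarrow> bool" where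
  "has_fourier_transform f g \<longleftrightarrow>
     g \<in> L2 \<and> ((\<lambda>r. L2_sq lborel (\<lambda>\<xi>. fourier_cutoff f r \<xi> - g \<xi>)) \<longlongrightarrow> 0) at_top"

definition fourier :: "(real \<Rightarrow> complex) \<Rightarrow> real \<Rightarrow> complex" where
  "fourier f = (SOME g. has_fourier_transform f g)"

definition sobolev_weighted_sq :: "real \<Rightarrow> (real \<Rightarrow> complex) \<Rightarrow> ennreal" where
  "sobolev_weighted_sq s g = (\<integral>\<^sup>+ \<xi>. ennreal ((1 + \<xi>\<^sup>2) powr s * (norm (g \<xi>))\<^sup>2) \<partial>lborel)"

text \<open>The space $H^s$ for $s \ge 0$, where it is contained in $L^2$. Its elements are Borel
  representatives of the classes modulo null sets.\<close>

definition Hs :: "real \<Rightarrow> (real \<Rightarrow> complex) set" where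
  "Hs s = {f \<in> L2. \<exists>g. has_fourier_transform f g \<and> sobolev_weighted_sq s g < \<infinity>}"

definition Hs_norm :: "real \<Rightarrow> (real \<Rightarrow> complex) \<Rightarrow> real" where
  "Hs_norm s f = sqrt (enn2real (sobolev_weighted_sq s (fourier f)))"

end

theory Submission
  imports Defs "HOL-Probability.Probability" "HOL-Real_Asymp.Real_Asymp"
begin

text \<open>Split the integral at a radius \<open>r\<close> instead of \<open>R\<close>: since
  \<open>|\<xi>|\<^sup>2\<^sup>\<theta> \<le> r\<^sup>2\<^sup>\<theta> + r\<^sup>2\<^sup>\<theta>\<^sup>-\<^sup>2 |\<xi>|\<^sup>2\<close>, conditions (ii) and (iv) bound the left-hand side by a
  combination of the three terms on the right in which the coefficient of the \<open>K\<^sub>0\<close> term is as small as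
  desired, at the cost of large coefficients for the other two. Condition (iii) at \<open>\<theta> = 0\<close> forces
  \<open>|f(t)|\<^sup>2 \<ge> \<Theta>(0)\<close> on a set of positive measure, so the Sobolev embedding bounds the \<open>H\<^sup>s\<close> norm
  of \<open>f(t)\<close> below by a constant \<open>b > 0\<close>. As \<open>\<rho> \<rightarrow> 0\<close>, \<open>b\<^sup>2\<^sup>\<rho> \<rightarrow> 1\<close> while the factors \<open>1/\<rho>\<close> in
  \<open>K\<^sub>1\<close> and \<open>K\<^sub>2\<close> blow up, so every small enough \<open>\<rho>\<close> works.

  The embedding is derived from the multiplication formula, tested against modulated Gaussians: all
  Gaussian averages of \<open>f\<close> are bounded by the \<open>L\<^sup>1\<close> norm of its transform.\<close>

subsection \<open>The Sobolev embedding\<close>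

lemma borel_measurable_cis [measurable]: "cis \<in> borel_measurable borel"
  by (intro borel_measurable_continuous_onI continuous_on_cis continuous_on_id)

lemma L2_iff: "f \<in> L2 \<longleftrightarrow> f \<in> borel_measurable borel \<and> integrable lborel (\<lambda>x. (norm (f x))\<^sup>2)"
  unfolding L2_def L2_sq_def by (auto simp: integrable_iff_bounded)

lemma L2_integrable_mult:
  assumes "f \<in> L2" "h \<in> L2"
  shows "integrable lborel (\<lambda>x. f x * h x)"
proof (rule Bochner_Integration.integrable_bound)
  show "integrable lborel (\<lambda>x. (norm (f x))\<^sup>2 + (norm (h x))\<^sup>2)"
    using assms by (auto simp: L2_iff)
  show "(\<lambda>x. f x * h x) \<in> borel_measurable lborel"
    using assms by (auto simp: L2_iff)
  show "AE x in lborel. norm (f x * h x) \<le> norm ((norm (f x))\<^sup>2 + (norm (h x))\<^sup>2)"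
  proof (rule AE_I2)
    fix x
    have "2 * norm (f x) * norm (h x) \<le> (norm (f x))\<^sup>2 + (norm (h x))\<^sup>2"
      by (rule sum_squares_bound)
    moreover have "0 \<le> norm (f x) * norm (h x)" by simp
    ultimately have "norm (f x) * norm (h x) \<le> (norm (f x))\<^sup>2 + (norm (h x))\<^sup>2"
      by linarith
    then show "norm (f x * h x) \<le> norm ((norm (f x))\<^sup>2 + (norm (h x))\<^sup>2)"
      by (simp add: norm_mult)
  qed
qed

text \<open>Cauchy-Schwarz in squared form, so that the squared distances in
  \<open>has_fourier_transform\<close> enter directly.\<close>

lemma nn_integral_norm_mult_le:
  fixes f h :: "real \<Rightarrow> complex"
  assumes [measurable]: "f \<in> borel_measurable borel" "h \<in> borel_measurable borel"
  shows "(\<integral>\<^sup>+ x. ennreal (norm (f x * h x)) \<partial>lborel)\<^sup>2 \<le> L2_sq lborel f * L2_sq lborel h"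
  using Cauchy_Schwarz_nn_integral[of "\<lambda>x. ennreal (norm (f x))" lborel "\<lambda>x. ennreal (norm (h x))"]
  by (simp add: L2_sq_def norm_mult ennreal_mult ennreal_power)

lemma L2_bounded:
  assumes "integrable lborel f" "\<And>x. norm (f x) \<le> b"
  shows "f \<in> L2"
proof -
  have [measurable]: "f \<in> borel_measurable borel" using assms(1) by auto
  have "integrable lborel (\<lambda>x. (norm (f x))\<^sup>2)"
  proof (rule Bochner_Integration.integrable_bound)
    show "integrable lborel (\<lambda>x. b * norm (f x))"
      using assms(1) by auto
    show "AE x in lborel. norm ((norm (f x))\<^sup>2) \<le> norm (b * norm (f x))"
      using assms(2) order_trans[OF norm_ge_zero assms(2)]
      by (auto simp: power2_eq_square intro!: mult_right_mono)
  qed simp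
  then show ?thesis by (simp add: L2_iff)
qed

text \<open>Pairs \<open>f\<close> with the square-integrable indicator. The truncated integrals in
  \<open>fourier_cutoff\<close> are thus true integrals and not the default value 0 of a
  non-integrable function.\<close>

lemma L2_restrict_integrable:
  assumes "f \<in> L2"
  shows "integrable lborel (\<lambda>x. indicator {a..b} x *\<^sub>R f x)"
proof -
  have "(\<lambda>x. complex_of_real (indicator {a..b} x)) \<in> L2"
  proof (rule L2_bounded[where b=1])
    have "integrable lborel (indicator {a..b} :: real \<Rightarrow> real)"
      by (rule integrable_real_indicator) (auto simp: emeasure_lborel_Icc_eq)
    then show "integrable lborel (\<lambda>x. complex_of_real (indicator {a..b} x))"
      by (rule integrable_of_real)
  qed (auto split: split_indicator)
  from L2_integrable_mult[OF this assms] show ?thesis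
    by (simp add: scaleR_conv_of_real)
qed

section \<open>The multiplication formula\<close>

text \<open>For \<open>f\<close> truncated to \<open>{-n..n}\<close>, Fubini moves the transform
  from \<open>f\<close> to \<open>\<phi>\<close>. Then \<open>n\<close> tends to infinity: the
  cutoffs converge to \<open>g\<close> in the mean square, which Cauchy-Schwarz turns into
  convergence against \<open>\<phi>\<close>, and the other side converges by domination. The factor
  \<open>sqrt (2 * pi)\<close> appears because \<open>\<Phi>\<close> is the transform of
  \<open>\<phi>\<close> without normalisation.\<close>

lemma fourier_multiplication_formula:
  assumes f: "f \<in> L2" and fg: "has_fourier_transform f g"
    and \<phi>: "\<phi> \<in> L2" "integrable lborel \<phi>"
    and \<Phi>: "\<And>y. \<Phi> y = (LINT \<xi>|lborel. cis (- (y * \<xi>)) * \<phi> \<xi>)" "\<Phi> \<in> L2"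
  shows "(LINT y|lborel. f y * \<Phi> y) = complex_of_real (sqrt (2 * pi)) * (LINT \<xi>|lborel. g \<xi> * \<phi> \<xi>)"
proof -
  have g: "g \<in> L2" and lim: "((\<lambda>r. L2_sq lborel (\<lambda>\<xi>. fourier_cutoff f r \<xi> - g \<xi>)) \<longlongrightarrow> 0) at_top"
    using fg by (auto simp: has_fourier_transform_def)
  have [measurable]: "f \<in> borel_measurable borel" "g \<in> borel_measurable borel"
      "\<phi> \<in> borel_measurable borel" "\<Phi> \<in> borel_measurable borel"
    using f g \<phi> \<Phi>(2) by (auto simp: L2_iff)
  define c where "c = complex_of_real (1 / sqrt (2 * pi))"
  let ?F = "\<lambda>n. fourier_cutoff f (real n)"
  let ?f = "\<lambda>n x. indicator {-real n..real n} x *\<^sub>R f x"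
  have F_eq: "?F n \<xi> = c * (LINT x|lborel. ?f n x * cis (- (x * \<xi>)))" for n \<xi>
    unfolding fourier_cutoff_def c_def set_lebesgue_integral_def by simp
  have F_meas [measurable]: "?F n \<in> borel_measurable borel" for n
    unfolding F_eq by measurable
  have int_f: "integrable lborel (?f n)" for n
    by (rule L2_restrict_integrable[OF f])
  \<comment> \<open>As \<open>cis\<close> has modulus 1, the integrand has the modulus of a product
    of two integrable functions of one variable each.\<close>
  have pair: "integrable (lborel \<Otimes>\<^sub>M lborel) (\<lambda>(x, \<xi>). ?f n x * cis (- (x * \<xi>)) * \<phi> \<xi>)" for n
  proof (intro lborel_pair.Fubini_integrable)
    show "(\<lambda>(x, \<xi>). ?f n x * cis (- (x * \<xi>)) * \<phi> \<xi>) \<in> borel_measurable (lborel \<Otimes>\<^sub>M lborel)"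
      by measurable
    have "integrable lborel (\<lambda>x. norm (?f n x) * (LINT \<xi>|lborel. norm (\<phi> \<xi>)))"
      by (intro integrable_mult_left integrable_norm int_f)
    moreover have "(LINT y|lborel. norm (case (x, y) of (x, \<xi>) \<Rightarrow> ?f n x * cis (- (x * \<xi>)) * \<phi> \<xi>))
      = norm (?f n x) * (LINT \<xi>|lborel. norm (\<phi> \<xi>))" for x
      by (simp add: norm_mult)
    ultimately show "integrable lborel (\<lambda>x. LINT y|lborel. norm (case (x, y) of (x, \<xi>) \<Rightarrow> ?f n x * cis (- (x * \<xi>)) * \<phi> \<xi>))"
      by (simp only:)
    have "integrable lborel (\<lambda>\<xi>. cis (- (x * \<xi>)) * \<phi> \<xi>)" for x
      by (rule Bochner_Integration.integrable_bound[OF \<phi>(2)]) (auto simp: norm_mult)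
    then show "AE x in lborel. integrable lborel (\<lambda>y. case (x, y) of (x, \<xi>) \<Rightarrow> ?f n x * cis (- (x * \<xi>)) * \<phi> \<xi>)"
      by (simp add: mult.assoc)
  qed
  have F_phi: "?F n \<xi> * \<phi> \<xi> = c * (LINT x|lborel. ?f n x * cis (- (x * \<xi>)) * \<phi> \<xi>)" for n \<xi>
    by (subst integral_mult_left_zero) (simp only: F_eq mult.assoc)
  then have int_F: "integrable lborel (\<lambda>\<xi>. ?F n \<xi> * \<phi> \<xi>)" for n
    using lborel_pair.integrable_snd[OF pair[of n]]
    by (simp only: integrable_mult_right)
  have fubini: "(LINT \<xi>|lborel. ?F n \<xi> * \<phi> \<xi>) = c * (LINT x|lborel. ?f n x * \<Phi> x)" for n
    unfolding F_phi integral_mult_right_zero lborel_pair.Fubini_integral[OF pair[of n]] \<Phi>(1)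
    by (simp add: mult.assoc)
  have int_g: "integrable lborel (\<lambda>\<xi>. g \<xi> * \<phi> \<xi>)"
    by (rule L2_integrable_mult[OF g \<phi>(1)])
  have "(\<lambda>n. (norm ((LINT \<xi>|lborel. ?F n \<xi> * \<phi> \<xi>) - (LINT \<xi>|lborel. g \<xi> * \<phi> \<xi>)))\<^sup>2) \<longlonglongrightarrow> 0"
  proof -
    have le: "ennreal ((norm ((LINT \<xi>|lborel. ?F n \<xi> * \<phi> \<xi>) - (LINT \<xi>|lborel. g \<xi> * \<phi> \<xi>)))\<^sup>2)
      \<le> L2_sq lborel (\<lambda>\<xi>. ?F n \<xi> - g \<xi>) * L2_sq lborel \<phi>" for n
    proof -
      have "(LINT \<xi>|lborel. ?F n \<xi> * \<phi> \<xi>) - (LINT \<xi>|lborel. g \<xi> * \<phi> \<xi>)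
        = (LINT \<xi>|lborel. (?F n \<xi> - g \<xi>) * \<phi> \<xi>)"
        by (simp add: int_F int_g left_diff_distrib)
      moreover have "integrable lborel (\<lambda>\<xi>. (?F n \<xi> - g \<xi>) * \<phi> \<xi>)"
        using int_F int_g by (simp add: left_diff_distrib)
      ultimately have "ennreal (norm ((LINT \<xi>|lborel. ?F n \<xi> * \<phi> \<xi>) - (LINT \<xi>|lborel. g \<xi> * \<phi> \<xi>)))
        \<le> (\<integral>\<^sup>+ \<xi>. norm ((?F n \<xi> - g \<xi>) * \<phi> \<xi>) \<partial>lborel)"
        by (simp only: integral_norm_bound_ennreal)
      then have "(ennreal (norm ((LINT \<xi>|lborel. ?F n \<xi> * \<phi> \<xi>) - (LINT \<xi>|lborel. g \<xi> * \<phi> \<xi>))))\<^sup>2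
        \<le> (\<integral>\<^sup>+ \<xi>. norm ((?F n \<xi> - g \<xi>) * \<phi> \<xi>) \<partial>lborel)\<^sup>2"
        by (rule power_mono) simp
      also have "\<dots> \<le> L2_sq lborel (\<lambda>\<xi>. ?F n \<xi> - g \<xi>) * L2_sq lborel \<phi>"
        by (rule nn_integral_norm_mult_le) auto
      finally show ?thesis by (simp add: ennreal_power)
    qed
    \<comment> \<open>Multiplication in \<open>ennreal\<close> is not continuous where 0 meets
      \<open>\<infinity>\<close>, so the limit of the product needs this factor to be
      finite.\<close>
    have "L2_sq lborel \<phi> \<noteq> \<infinity>"
      using \<phi>(1) by (auto simp: L2_def)
    then have prod: "(\<lambda>n. L2_sq lborel (\<lambda>\<xi>. ?F n \<xi> - g \<xi>) * L2_sq lborel \<phi>) \<longlonglongrightarrow> 0 * L2_sq lborel \<phi>"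
      by (intro tendsto_mult_ennreal[OF filterlim_compose[OF lim filterlim_real_sequentially] tendsto_const]) simp
    have "(\<lambda>n. ennreal ((norm ((LINT \<xi>|lborel. ?F n \<xi> * \<phi> \<xi>) - (LINT \<xi>|lborel. g \<xi> * \<phi> \<xi>)))\<^sup>2)) \<longlonglongrightarrow> 0"
      by (rule tendsto_sandwich[OF _ _ tendsto_const prod[simplified]]) (simp_all add: le)
    then show ?thesis by (subst (asm) ennreal_tendsto_0_iff) auto
  qed
  then have "(\<lambda>n. norm ((LINT \<xi>|lborel. ?F n \<xi> * \<phi> \<xi>) - (LINT \<xi>|lborel. g \<xi> * \<phi> \<xi>))) \<longlonglongrightarrow> 0"
    using tendsto_real_sqrt by fastforce
  then have "(\<lambda>n. LINT \<xi>|lborel. ?F n \<xi> * \<phi> \<xi>) \<longlonglongrightarrow> (LINT \<xi>|lborel. g \<xi> * \<phi> \<xi>)"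
    by (simp add: tendsto_norm_zero_iff LIM_zero_iff)
  moreover have "(\<lambda>n. LINT x|lborel. ?f n x * \<Phi> x) \<longlonglongrightarrow> (LINT x|lborel. f x * \<Phi> x)"
  proof (rule integral_dominated_convergence)
    show "integrable lborel (\<lambda>x. norm (f x * \<Phi> x))"
      by (intro integrable_norm L2_integrable_mult f \<Phi>(2))
    show "AE x in lborel. (\<lambda>n. ?f n x * \<Phi> x) \<longlonglongrightarrow> f x * \<Phi> x"
    proof (rule AE_I2)
      fix x
      obtain N where N: "\<bar>x\<bar> \<le> real N" using real_arch_simple by blast
      have "eventually (\<lambda>n. ?f n x * \<Phi> x = f x * \<Phi> x) sequentially"
        using eventually_ge_at_top[of N] by eventually_elim (use N in \<open>auto simp: indicator_def\<close>)
      then show "(\<lambda>n. ?f n x * \<Phi> x) \<longlonglongrightarrow> f x * \<Phi> x"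
        by (rule tendsto_eventually)
    qed
  qed (auto simp: norm_mult split: split_indicator)
  then have "(\<lambda>n. LINT \<xi>|lborel. ?F n \<xi> * \<phi> \<xi>) \<longlonglongrightarrow> c * (LINT x|lborel. f x * \<Phi> x)"
    unfolding fubini by (intro tendsto_intros)
  ultimately have "(LINT \<xi>|lborel. g \<xi> * \<phi> \<xi>) = c * (LINT x|lborel. f x * \<Phi> x)"
    by (rule LIMSEQ_unique)
  moreover have "complex_of_real (sqrt (2 * pi)) * c = 1"
    unfolding c_def by (simp flip: of_real_mult)
  ultimately show ?thesis
    by (simp flip: mult.assoc)
qed

section \<open>Gaussian averages\<close>

lemma integral_cis_std_normal_density:
  "(LINT z|lborel. cis (t * z) * complex_of_real (std_normal_density z)) = complex_of_real (exp (- t\<^sup>2 / 2))"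
proof -
  have "complex_of_real (exp (- t\<^sup>2 / 2)) = char std_normal_distribution t"
    by (simp add: char_std_normal_distribution)
  also have "\<dots> = (LINT z|lborel. std_normal_density z *\<^sub>R cis (t * z))"
    unfolding char_def by (subst integral_density) (auto simp: cis_conv_exp)
  finally show ?thesis by (simp add: scaleR_conv_of_real mult.commute)
qed

lemma normal_density_affine_std:
  "\<epsilon> > 0 \<Longrightarrow> normal_density x \<epsilon> (x + \<epsilon> * z) = std_normal_density z / \<epsilon>"
  by (simp add: normal_density_def power_mult_distrib real_sqrt_mult)

lemma normal_density_le: "\<sigma> > 0 \<Longrightarrow> normal_density \<mu> \<sigma> x \<le> 1 / (\<sigma> * sqrt (2 * pi))"
  by (simp add: normal_density_def real_sqrt_mult field_simps)

text \<open>Up to a factor, the Gaussian of centre \<open>x\<close> and width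
  \<open>\<epsilon>\<close> is the transform of a modulated Gaussian \<open>\<phi>\<close> of
  modulus at most \<open>1 / sqrt (2 * pi)\<close>. The multiplication formula turns the average of
  \<open>f\<close> into the integral of \<open>g\<close> against \<open>\<phi>\<close>. The point is
  that the bound depends neither on \<open>x\<close> nor on \<open>\<epsilon>\<close>.\<close>

lemma norm_gaussian_average_le:
  assumes f: "f \<in> L2" and fg: "has_fourier_transform f g" and g: "integrable lborel g"
    and \<epsilon>: "\<epsilon> > 0"
  shows "norm (LINT y|lborel. f y * complex_of_real (normal_density x \<epsilon> y))
    \<le> (LINT \<xi>|lborel. norm (g \<xi>)) / sqrt (2 * pi)"
proof -
  \<comment> \<open>The factor \<open>cis (x * \<xi>)\<close> moves the centre of the transform to
    \<open>x\<close>; the scaling by \<open>\<epsilon>\<close> gives it width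
    \<open>\<epsilon>\<close>.\<close>
  define \<phi> where "\<phi> \<xi> = cis (x * \<xi>) * complex_of_real (std_normal_density (\<epsilon> * \<xi>))" for \<xi>
  have [measurable]: "\<phi> \<in> borel_measurable borel" unfolding \<phi>_def by measurable
  have "integrable lborel (\<lambda>\<xi>. std_normal_density (0 + \<epsilon> * \<xi>))"
    using \<epsilon> by (intro lborel_integrable_real_affine) auto
  then have \<phi>_int: "integrable lborel \<phi>"
    by (rule Bochner_Integration.integrable_bound) (auto simp: \<phi>_def norm_mult)
  have \<phi>_le: "norm (\<phi> \<xi>) \<le> 1 / sqrt (2 * pi)" for \<xi>
    using normal_density_le[of 1 0 "\<epsilon> * \<xi>"] by (simp add: \<phi>_def norm_mult)
  have \<phi>_L2: "\<phi> \<in> L2"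
    using \<phi>_int \<phi>_le by (rule L2_bounded)
  define \<Phi> where "\<Phi> y = complex_of_real (sqrt (2 * pi) * normal_density x \<epsilon> y)" for y
  have \<Phi>: "\<Phi> y = (LINT \<xi>|lborel. cis (- (y * \<xi>)) * \<phi> \<xi>)" for y
  proof -
    have "complex_of_real (exp (- ((x - y) / \<epsilon>)\<^sup>2 / 2)) =
        (LINT z|lborel. cis ((x - y) / \<epsilon> * z) * complex_of_real (std_normal_density z))"
      by (rule integral_cis_std_normal_density[symmetric])
    \<comment> \<open>Substitution \<open>z = \<epsilon> * \<xi>\<close> in the characteristic
      function of the normal law at \<open>(x - y) / \<epsilon>\<close>.\<close>
    also have "\<dots> = \<epsilon> *\<^sub>R (LINT \<xi>|lborel. cis ((x - y) / \<epsilon> * (0 + \<epsilon> * \<xi>)) * complex_of_real (std_normal_density (0 + \<epsilon> * \<xi>)))"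
      using \<epsilon> by (subst lborel_integral_real_affine[where c=\<epsilon> and t=0]) auto
    also have "\<dots> = \<epsilon> *\<^sub>R (LINT \<xi>|lborel. cis (- (y * \<xi>)) * \<phi> \<xi>)"
    proof -
      have "(x - y) / \<epsilon> * (0 + \<epsilon> * \<xi>) = - (y * \<xi>) + x * \<xi>" for \<xi>
        using \<epsilon> by (simp add: field_simps)
      then have "cis ((x - y) / \<epsilon> * (0 + \<epsilon> * \<xi>)) = cis (- (y * \<xi>)) * cis (x * \<xi>)" for \<xi>
        by (simp only: cis_mult)
      then show ?thesis
        by (simp only: \<phi>_def mult.assoc add_0_left)
    qed
    finally have eq: "complex_of_real (exp (- ((x - y) / \<epsilon>)\<^sup>2 / 2)) / \<epsilon> = (LINT \<xi>|lborel. cis (- (y * \<xi>)) * \<phi> \<xi>)"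
      using \<epsilon> by (simp add: scaleR_conv_of_real)
    have "sqrt (2 * pi) * normal_density x \<epsilon> y = exp (- ((x - y) / \<epsilon>)\<^sup>2 / 2) / \<epsilon>"
      using \<epsilon> by (simp add: normal_density_def real_sqrt_mult power_divide power2_commute[of x y] mult.commute)
    then show ?thesis unfolding \<Phi>_def eq[symmetric] by simp
  qed
  have \<Phi>_L2: "\<Phi> \<in> L2"
    unfolding \<Phi>_def
  proof (rule L2_bounded)
    show "norm (complex_of_real (sqrt (2 * pi) * normal_density x \<epsilon> y)) \<le> sqrt (2 * pi) * (1 / (\<epsilon> * sqrt (2 * pi)))" for y
      using normal_density_le[OF \<epsilon>, of x y] \<epsilon> by (simp add: norm_mult field_simps)
  qed (use \<epsilon> in auto)
  have "complex_of_real (sqrt (2 * pi)) * (LINT y|lborel. f y * complex_of_real (normal_density x \<epsilon> y))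
     = (LINT y|lborel. f y * \<Phi> y)"
    by (simp add: \<Phi>_def mult_ac flip: integral_mult_right_zero)
  also have "\<dots> = complex_of_real (sqrt (2 * pi)) * (LINT \<xi>|lborel. g \<xi> * \<phi> \<xi>)"
    by (rule fourier_multiplication_formula[OF f fg \<phi>_L2 \<phi>_int \<Phi> \<Phi>_L2])
  finally have "norm (LINT y|lborel. f y * complex_of_real (normal_density x \<epsilon> y)) = norm (LINT \<xi>|lborel. g \<xi> * \<phi> \<xi>)"
    by simp
  also have "\<dots> \<le> (LINT \<xi>|lborel. norm (g \<xi>) * (1 / sqrt (2 * pi)))"
  proof (rule order_trans[OF integral_norm_bound integral_mono])
    show "integrable lborel (\<lambda>\<xi>. norm (g \<xi> * \<phi> \<xi>))"
      using fg \<phi>_L2 by (intro integrable_norm L2_integrable_mult) (auto simp: has_fourier_transform_def)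
    show "integrable lborel (\<lambda>\<xi>. norm (g \<xi>) * (1 / sqrt (2 * pi)))"
      using g by auto
    show "norm (g \<xi> * \<phi> \<xi>) \<le> norm (g \<xi>) * (1 / sqrt (2 * pi))" for \<xi>
      using \<phi>_le by (simp only: norm_mult) (intro mult_left_mono, auto)
  qed
  finally show ?thesis by simp
qed

text \<open>Comparison with 1 on \<open>{-1..1}\<close> and with
  \<open>\<bar>x\<bar> powr (- 2 * s)\<close> outside, whose tails are integrable as
  \<open>2 * s > 1\<close>. The left tail is the reflection of the right one.\<close>

lemma nn_integral_weight_finite:
  assumes "s > 1 / 2"
  shows "(\<integral>\<^sup>+ x. ennreal ((1 + x\<^sup>2) powr - s) \<partial>lborel) < \<infinity>"
proof -
  let ?h = "\<lambda>x::real. indicator {1..} x * x powr (- 2 * s)"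
  have "((\<lambda>x. x powr (- 2 * s)) has_integral -(1 powr (- 2 * s + 1)) / (- 2 * s + 1)) {1..}"
    using assms by (intro has_integral_powr_to_inf) auto
  then have h: "(\<integral>\<^sup>+ x. ennreal (?h x) \<partial>lborel) < \<infinity>"
    by (subst nn_integral_has_integral_lebesgue) auto
  then have h': "(\<integral>\<^sup>+ x. ennreal (?h (- x)) \<partial>lborel) < \<infinity>"
    by (subst (asm) nn_integral_real_affine[where c="-1" and t=0]) auto
  have pt: "(1 + x\<^sup>2) powr - s \<le> indicator {-1..1} x + ?h x + ?h (- x)" for x :: real
  proof (cases "\<bar>x\<bar> \<le> 1")
    case True
    have "(1 + x\<^sup>2) powr - s \<le> 1 powr - s"
      using assms by (intro powr_mono2') auto
    with True show ?thesis
      by (auto simp: abs_le_iff split: split_indicator)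
  next
    case False
    have "(1 + x\<^sup>2) powr - s \<le> (\<bar>x\<bar>\<^sup>2) powr - s"
      using assms False by (intro powr_mono2') auto
    also have "\<dots> = (\<bar>x\<bar> powr 2) powr - s"
      using False by (subst powr_numeral) auto
    also have "\<dots> = \<bar>x\<bar> powr (- 2 * s)"
      by (subst powr_powr) simp
    finally show ?thesis
      using False by (cases "x \<ge> 0") (auto split: split_indicator)
  qed
  have "(\<integral>\<^sup>+ x. ennreal ((1 + x\<^sup>2) powr - s) \<partial>lborel)
     \<le> (\<integral>\<^sup>+ x. indicator {-1..1} x + ennreal (?h x) + ennreal (?h (- x)) \<partial>lborel)"
  proof (intro nn_integral_mono)
    fix x :: real
    show "ennreal ((1 + x\<^sup>2) powr - s) \<le> indicator {-1..1} x + ennreal (?h x) + ennreal (?h (- x))"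
    proof -
      have "indicator {-1..1} x + ennreal (?h x) + ennreal (?h (- x))
        = ennreal (indicator {-1..1} x + ?h x + ?h (- x))"
        by (simp add: ennreal_indicator)
      then show ?thesis using ennreal_leI[OF pt[of x]] by (simp only:)
    qed
  qed
  also have "\<dots> = (\<integral>\<^sup>+ x. indicator {-1..1} x \<partial>(lborel :: real measure)) + (\<integral>\<^sup>+ x. ennreal (?h x) \<partial>lborel)
     + (\<integral>\<^sup>+ x. ennreal (?h (- x)) \<partial>(lborel :: real measure))"
    by (simp add: nn_integral_add)
  also have "\<dots> < \<infinity>"
    using h h' by (simp add: ennreal_add_eq_top less_top[symmetric])
  finally show ?thesis .
qed

lemma normal_density_commute: "normal_density x \<sigma> y = normal_density y \<sigma> x"
  by (simp add: normal_density_def power2_commute[of x y])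

text \<open>A decay estimate uniform in \<open>\<epsilon>\<close>, to serve as a majorant when
  \<open>\<epsilon>\<close> tends to 0. The bound \<open>exp (- v) \<le> 1 / v\<close> yields a
  factor \<open>\<epsilon>\<^sup>2\<close>, which absorbs the \<open>1 / \<epsilon>\<close> in front
  of the exponential.\<close>

lemma normal_density_far_le:
  assumes "0 < \<epsilon>" "\<epsilon> \<le> 1" "\<bar>x\<bar> \<le> m" "2 * m < \<bar>y\<bar>"
  shows "normal_density y \<epsilon> x \<le> 8 / y\<^sup>2"
proof -
  have y: "y \<noteq> 0" using assms by auto
  \<comment> \<open>The Gaussian exponent at distance \<open>\<bar>y\<bar> / 2\<close>, which is at
    most \<open>\<bar>x - y\<bar>\<close> here.\<close>
  define v where "v = y\<^sup>2 / (8 * \<epsilon>\<^sup>2)"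
  have ve: "v \<le> exp v" using exp_ge_add_one_self[of v] by linarith
  have v: "v > 0" using y assms by (simp add: v_def)
  have "(y / 2)\<^sup>2 \<le> (x - y)\<^sup>2"
  proof (rule abs_le_square_iff[THEN iffD1])
    show "\<bar>y / 2\<bar> \<le> \<bar>x - y\<bar>" using assms by linarith
  qed
  then have "v \<le> (x - y)\<^sup>2 / (2 * \<epsilon>\<^sup>2)"
    using assms by (simp add: v_def field_simps power_divide)
  then have "exp (- (x - y)\<^sup>2 / (2 * \<epsilon>\<^sup>2)) \<le> exp (- v)" by simp
  also have "\<dots> \<le> 1 / v"
    using ve v by (simp add: exp_minus field_simps)
  finally have e: "exp (- (x - y)\<^sup>2 / (2 * \<epsilon>\<^sup>2)) \<le> 1 / v" .
  have s: "1 \<le> sqrt (2 * pi)"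
    using pi_gt3 by (intro real_le_rsqrt) auto
  have s': "\<epsilon> / sqrt (2 * pi) \<le> 1"
    using assms order_trans[OF assms(2) s] by (simp add: divide_le_eq_1)
  have "normal_density y \<epsilon> x = 1 / (\<epsilon> * sqrt (2 * pi)) * exp (- (x - y)\<^sup>2 / (2 * \<epsilon>\<^sup>2))"
    using assms by (simp add: normal_density_def real_sqrt_mult)
  also have "\<dots> \<le> 1 / (\<epsilon> * sqrt (2 * pi)) * (1 / v)"
    using assms by (intro mult_left_mono e) auto
  also have "\<dots> = 8 / y\<^sup>2 * (\<epsilon> / sqrt (2 * pi))"
    using assms y by (simp add: v_def field_simps power2_eq_square)
  also have "\<dots> \<le> 8 / y\<^sup>2 * 1"
    by (intro mult_left_mono s') auto
  finally show ?thesis by simp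
qed

section \<open>From Gaussian averages to compact sets\<close>

text \<open>Replace \<open>\<psi>\<close> by its Gaussian mollification \<open>k \<epsilon>\<close>.
  By Fubini, the integral of \<open>f\<close> against \<open>k \<epsilon>\<close> is the integral of
  \<open>\<psi>\<close> against the Gaussian averages of \<open>f\<close>, all bounded by
  \<open>B\<close>. Then \<open>\<epsilon>\<close> tends to 0 under a majorant that is
  square-integrable, since \<open>f\<close> is only known to be in \<open>L2\<close>.\<close>

lemma norm_integral_mult_continuous_le:
  assumes f: "f \<in> L2"
    and B: "\<And>x \<epsilon>. \<epsilon> > 0 \<Longrightarrow> norm (LINT y|lborel. f y * complex_of_real (normal_density x \<epsilon> y)) \<le> B"
    and \<psi>: "continuous_on UNIV \<psi>" "\<And>x. 0 \<le> \<psi> x" "\<And>x. \<psi> x \<le> 1" "\<And>x. m < \<bar>x\<bar> \<Longrightarrow> \<psi> x = 0"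
    and m: "m \<ge> 1"
  shows "norm (LINT y|lborel. f y * complex_of_real (\<psi> y)) \<le> B * (LINT x|lborel. \<psi> x)"
proof -
  have [measurable]: "f \<in> borel_measurable borel" using f by (simp add: L2_iff)
  have [measurable]: "\<psi> \<in> borel_measurable borel" using \<psi>(1) by (rule borel_measurable_continuous_onI)
  have int_ind: "integrable lborel (indicator {-m..m} :: real \<Rightarrow> real)"
    by (rule integrable_real_indicator) (auto simp: emeasure_lborel_Icc_eq)
  have \<psi>_le: "\<psi> x \<le> indicator {-m..m} x" for x
    using \<psi>(3)[of x] \<psi>(4)[of x] by (auto simp: indicator_def abs_less_iff)
  have int_\<psi>: "integrable lborel \<psi>"
    by (rule Bochner_Integration.integrable_bound[OF int_ind]) (use \<psi>(2) \<psi>_le in auto)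
  define k where "k \<epsilon> y = (LINT x|lborel. \<psi> x * normal_density y \<epsilon> x)" for \<epsilon> y
  have int_k: "integrable lborel (\<lambda>x. \<psi> x * normal_density y \<epsilon> x)" if "\<epsilon> > 0" for \<epsilon> y
    by (rule Bochner_Integration.integrable_bound[OF integrable_normal_density[OF that, of y]])
      (use \<psi> in \<open>auto simp: abs_mult intro!: mult_left_le_one_le\<close>)
  have k_nonneg: "0 \<le> k \<epsilon> y" for \<epsilon> y
    unfolding k_def using \<psi>(2) by (intro Bochner_Integration.integral_nonneg) auto
  have [measurable]: "k \<epsilon> \<in> borel_measurable borel" for \<epsilon>
    unfolding k_def normal_density_def by measurable
  \<comment> \<open>The part \<open>1 + 4 * m\<^sup>2\<close> bounds \<open>1 + y\<^sup>2\<close>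
    for \<open>\<bar>y\<bar> \<le> 2 * m\<close>, where \<open>k \<epsilon> y \<le> 1\<close>
    suffices. The part \<open>32 * m\<close> serves the other \<open>y\<close>: integrating
    \<open>8 / y\<^sup>2\<close> over \<open>{-m..m}\<close> gives
    \<open>16 * m / y\<^sup>2\<close>, and \<open>1 \<le> y\<^sup>2\<close> there.\<close>
  define D where "D = 1 + 4 * m\<^sup>2 + 32 * m"
  have k_le: "k \<epsilon> y \<le> D / (1 + y\<^sup>2)" if \<epsilon>: "0 < \<epsilon>" "\<epsilon> \<le> 1" for \<epsilon> y
  proof (cases "2 * m < \<bar>y\<bar>")
    case False
    have "k \<epsilon> y \<le> (LINT x|lborel. normal_density y \<epsilon> x)"
      unfolding k_def using \<psi> \<epsilon> by (intro integral_mono int_k) (auto intro!: mult_left_le_one_le)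
    also have "\<dots> = 1" using \<epsilon> by simp
    finally have "k \<epsilon> y \<le> 1" .
    moreover have "y\<^sup>2 \<le> (2 * m)\<^sup>2"
      using False m by (intro abs_le_square_iff[THEN iffD1]) auto
    then have "1 + y\<^sup>2 \<le> D" using m by (simp add: D_def power_mult_distrib)
    then have "1 \<le> D / (1 + y\<^sup>2)"
      by (subst le_divide_eq_1_pos) (auto simp: add_pos_nonneg)
    ultimately show ?thesis by linarith
  next
    case True
    then have "1 < \<bar>y\<bar>" using m by linarith
    then have y: "1 \<le> y\<^sup>2" using abs_le_square_iff[of 1 y] by simp
    have "k \<epsilon> y \<le> (LINT x|lborel. indicator {-m..m} x * (8 / y\<^sup>2))"
      unfolding k_def
    proof (intro integral_mono int_k \<epsilon>)
      show "\<psi> x * normal_density y \<epsilon> x \<le> indicator {-m..m} x * (8 / y\<^sup>2)" for x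
      proof (cases "\<bar>x\<bar> \<le> m")
        case in_range: True
        have "\<psi> x * normal_density y \<epsilon> x \<le> 1 * (8 / y\<^sup>2)"
          using \<psi> normal_density_far_le[OF \<epsilon> in_range True] by (intro mult_mono) auto
        with in_range show ?thesis by (auto simp: abs_le_iff)
      next
        case False
        with \<psi>(4)[of x] show ?thesis by auto
      qed
    qed (use int_ind in auto)
    also have "\<dots> = 16 * m / y\<^sup>2" using m by simp
    also have "\<dots> \<le> 16 * m / ((1 + y\<^sup>2) / 2)"
      using y m by (intro divide_left_mono mult_pos_pos) auto
    also have "\<dots> = 32 * m / (1 + y\<^sup>2)" by simp
    also have "\<dots> \<le> D / (1 + y\<^sup>2)"
      by (intro divide_right_mono) (auto simp: D_def add_nonneg_nonneg)
    finally show ?thesis .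
  qed
  define w where "w y = complex_of_real (D / (1 + y\<^sup>2))" for y
  have D: "D \<ge> 0" using m by (simp add: D_def)
  have "integrable lborel (\<lambda>y::real. 1 / (1 + y\<^sup>2))"
  proof (rule integrableI_bounded)
    have "(\<integral>\<^sup>+ y. ennreal ((1 + y\<^sup>2) powr - 1) \<partial>lborel) < \<infinity>"
      by (rule nn_integral_weight_finite) simp
    moreover have "norm (1 / (1 + y\<^sup>2)) = (1 + y\<^sup>2) powr - 1" for y :: real
      by (subst powr_minus) (simp add: add_nonneg_nonneg inverse_eq_divide)
    ultimately show "(\<integral>\<^sup>+ y. ennreal (norm (1 / (1 + (y::real)\<^sup>2))) \<partial>lborel) < \<infinity>"
      by simp
  qed simp
  then have "integrable lborel (\<lambda>y::real. D * (1 / (1 + y\<^sup>2)))"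
    by (rule integrable_mult_right)
  then have int_w: "integrable lborel w"
    unfolding w_def by (intro integrable_of_real) simp
  have norm_w: "norm (w y) = D / (1 + y\<^sup>2)" for y
    using D unfolding w_def norm_of_real by (simp add: add_nonneg_nonneg)
  have w_le: "norm (w y) \<le> D" for y
  proof -
    have "0 < 1 + y\<^sup>2" by (simp add: add_pos_nonneg)
    then show ?thesis using D mult_left_mono[of 1 "1 + y\<^sup>2" D]
      unfolding norm_w by (simp add: pos_divide_le_eq)
  qed
  have "w \<in> L2" using int_w w_le by (rule L2_bounded)
  then have int_fw: "integrable lborel (\<lambda>y. norm (f y * w y))"
    by (intro integrable_norm L2_integrable_mult f)
  have k_w: "norm (f y * complex_of_real (k \<epsilon> y)) \<le> norm (f y * w y)" if "0 < \<epsilon>" "\<epsilon> \<le> 1" for \<epsilon> y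
    using mult_left_mono[OF k_le[OF that, of y], of "norm (f y)"] k_nonneg[of \<epsilon> y]
    by (simp add: norm_mult norm_w)
  have mollified: "norm (LINT y|lborel. f y * complex_of_real (k \<epsilon> y)) \<le> B * (LINT x|lborel. \<psi> x)"
    if \<epsilon>: "0 < \<epsilon>" "\<epsilon> \<le> 1" for \<epsilon>
  proof -
    let ?G = "\<lambda>y x. f y * complex_of_real (\<psi> x * normal_density y \<epsilon> x)"
    have pair: "integrable (lborel \<Otimes>\<^sub>M lborel) (\<lambda>(y, x). ?G y x)"
    proof (intro lborel_pair.Fubini_integrable)
      show "(\<lambda>(y, x). ?G y x) \<in> borel_measurable (lborel \<Otimes>\<^sub>M lborel)"
        unfolding normal_density_def by measurable
      have "(LINT x|lborel. norm (?G y x)) = norm (f y) * k \<epsilon> y" for y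
        using \<psi>(2) by (simp add: norm_mult abs_mult k_def)
      moreover have "integrable lborel (\<lambda>y. norm (f y) * k \<epsilon> y)"
        by (rule Bochner_Integration.integrable_bound[OF int_fw])
          (use k_w[OF \<epsilon>] k_nonneg in \<open>auto simp: norm_mult\<close>)
      ultimately show "integrable lborel (\<lambda>y. LINT x|lborel. norm (case (y, x) of (y, x) \<Rightarrow> ?G y x))"
        by simp
      show "AE y in lborel. integrable lborel (\<lambda>x. case (y, x) of (y, x) \<Rightarrow> ?G y x)"
        unfolding prod.case
        by (intro AE_I2 integrable_mult_right integrable_of_real int_k \<epsilon>)
    qed
    \<comment> \<open>The Gaussian is symmetric in centre and argument, so integrating over the
      centre \<open>y\<close> gives the average of \<open>f\<close> around \<open>x\<close>, to
      which \<open>B\<close> applies.\<close>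
    have inner: "(LINT y|lborel. ?G y x)
        = complex_of_real (\<psi> x) * (LINT y|lborel. f y * complex_of_real (normal_density x \<epsilon> y))" for x
      by (subst integral_mult_right_zero[symmetric])
        (simp add: normal_density_commute[of x] mult_ac)
    have "(LINT y|lborel. f y * complex_of_real (k \<epsilon> y)) = (LINT y|lborel. LINT x|lborel. ?G y x)"
      by (simp only: integral_mult_right_zero k_def integral_complex_of_real)
    also have "\<dots> = (LINT x|lborel. LINT y|lborel. ?G y x)"
      by (rule lborel_pair.Fubini_integral[OF pair, symmetric])
    also have "norm \<dots> \<le> (LINT x|lborel. B * \<psi> x)"
    proof (rule order_trans[OF integral_norm_bound integral_mono])
      show "integrable lborel (\<lambda>x. norm (LINT y|lborel. ?G y x))"
        by (intro integrable_norm lborel_pair.integrable_snd[OF pair])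
      show "integrable lborel (\<lambda>x. B * \<psi> x)" using int_\<psi> by auto
      show "norm (LINT y|lborel. ?G y x) \<le> B * \<psi> x" for x
        unfolding inner norm_mult using mult_right_mono[OF B[OF \<epsilon>(1), of x] \<psi>(2)[of x]] \<psi>(2)[of x]
        by (simp add: mult.commute)
    qed
    finally show ?thesis by simp
  qed
  define \<epsilon> where "\<epsilon> n = inverse (real (Suc n))" for n
  have \<epsilon>: "0 < \<epsilon> n" "\<epsilon> n \<le> 1" for n
    by (auto simp: \<epsilon>_def field_simps)
  have \<epsilon>_lim: "\<epsilon> \<longlonglongrightarrow> 0" unfolding \<epsilon>_def by (rule LIMSEQ_inverse_real_of_nat)
  have k_lim: "(\<lambda>n. k (\<epsilon> n) y) \<longlonglongrightarrow> \<psi> y" for y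
  proof -
    \<comment> \<open>The substitution \<open>x = y + \<epsilon> n * z\<close> moves
      \<open>\<epsilon> n\<close> into the argument of \<open>\<psi>\<close>: continuity gives the
      pointwise limit, and \<open>\<psi> \<le> 1\<close> makes the fixed normal density a
      majorant.\<close>
    have k_eq: "k (\<epsilon> n) y = (LINT z|lborel. \<psi> (y + \<epsilon> n * z) * std_normal_density z)" for n
      unfolding k_def using \<epsilon>[of n]
      by (subst lborel_integral_real_affine[where c="\<epsilon> n" and t=y]) (auto simp: normal_density_affine_std)
    have "(\<lambda>n. LINT z|lborel. \<psi> (y + \<epsilon> n * z) * std_normal_density z)
        \<longlonglongrightarrow> (LINT z|lborel. \<psi> y * std_normal_density z)"
    proof (rule integral_dominated_convergence)
      show "integrable lborel std_normal_density" by simp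
      show "AE z in lborel. (\<lambda>n. \<psi> (y + \<epsilon> n * z) * std_normal_density z) \<longlonglongrightarrow> \<psi> y * std_normal_density z"
      proof (rule AE_I2)
        fix z
        have "(\<lambda>n. y + \<epsilon> n * z) \<longlonglongrightarrow> y + 0 * z"
          by (intro tendsto_intros \<epsilon>_lim)
        moreover have "isCont \<psi> y"
          using \<psi>(1) by (simp add: continuous_on_eq_continuous_at)
        ultimately have "(\<lambda>n. \<psi> (y + \<epsilon> n * z)) \<longlonglongrightarrow> \<psi> y"
          by (intro isCont_tendsto_compose[of y \<psi>]) auto
        then show "(\<lambda>n. \<psi> (y + \<epsilon> n * z) * std_normal_density z) \<longlonglongrightarrow> \<psi> y * std_normal_density z"
          by (intro tendsto_intros)
      qed
      show "AE z in lborel. norm (\<psi> (y + \<epsilon> n * z) * std_normal_density z) \<le> std_normal_density z" for n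
        using \<psi>(2,3) by (auto simp: abs_mult intro!: mult_left_le_one_le)
    qed auto
    then show ?thesis unfolding k_eq by simp
  qed
  have "(\<lambda>n. LINT y|lborel. f y * complex_of_real (k (\<epsilon> n) y)) \<longlonglongrightarrow> (LINT y|lborel. f y * complex_of_real (\<psi> y))"
  proof (rule integral_dominated_convergence[OF _ _ int_fw])
    show "AE y in lborel. (\<lambda>n. f y * complex_of_real (k (\<epsilon> n) y)) \<longlonglongrightarrow> f y * complex_of_real (\<psi> y)"
      by (intro AE_I2 tendsto_intros k_lim)
  qed (use k_w[OF \<epsilon>] in auto)
  then have "(\<lambda>n. norm (LINT y|lborel. f y * complex_of_real (k (\<epsilon> n) y))) \<longlonglongrightarrow> norm (LINT y|lborel. f y * complex_of_real (\<psi> y))"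
    by (rule tendsto_norm)
  then show ?thesis
    by (rule LIMSEQ_le_const2) (use mollified[OF \<epsilon>] in auto)
qed

text \<open>Tent functions of the distance to \<open>K\<close>, with slopes growing to infinity,
  decrease to the indicator of \<open>K\<close> inside one bounded interval. Dominated convergence
  passes the bound for continuous functions to the limit on both sides.\<close>

lemma norm_integral_compact_le:
  assumes f: "f \<in> L2"
    and B: "\<And>x \<epsilon>. \<epsilon> > 0 \<Longrightarrow> norm (LINT y|lborel. f y * complex_of_real (normal_density x \<epsilon> y)) \<le> B"
    and K: "compact K"
  shows "norm (LINT y|lborel. f y * complex_of_real (indicator K y)) \<le> B * measure lborel K"
\<comment> \<open>The empty set is treated apart: \<open>infdist x {}\<close> is 0 by convention,
  which would make every \<open>\<psi> n\<close> constantly 1.\<close>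
proof (cases "K = {}")
  case False
  have [measurable]: "f \<in> borel_measurable borel" using f by (simp add: L2_iff)
  have K_borel [measurable]: "K \<in> sets borel" using K by (rule borel_compact)
  obtain a where a: "\<And>x. x \<in> K \<Longrightarrow> \<bar>x\<bar> \<le> a"
    using compact_imp_bounded[OF K] by (auto simp: bounded_iff)
  \<comment> \<open>The margin 1 puts every point with \<open>m < \<bar>x\<bar>\<close> at distance
    at least 1 from \<open>K\<close>, where even the flattest tent \<open>\<psi> 0\<close> vanishes.
    It also ensures \<open>m \<ge> 1\<close>.\<close>
  define m where "m = \<bar>a\<bar> + 1"
  define \<psi> where "\<psi> n x = max 0 (1 - real (Suc n) * infdist x K)" for n x
  have cont: "continuous_on UNIV (\<psi> n)" for n
    unfolding \<psi>_def by (intro continuous_intros)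
  have [measurable]: "\<psi> n \<in> borel_measurable borel" for n
    by (rule borel_measurable_continuous_onI[OF cont])
  have range: "0 \<le> \<psi> n x" "\<psi> n x \<le> 1" for n x
    by (auto simp: \<psi>_def infdist_nonneg)
  have supp: "\<psi> n x = 0" if "m < \<bar>x\<bar>" for n x
  proof -
    have "1 \<le> dist x y" if "y \<in> K" for y
      using a[OF that] \<open>m < \<bar>x\<bar>\<close> by (auto simp: dist_real_def m_def)
    then have "1 \<le> infdist x K"
      unfolding infdist_def using False by (auto intro!: cINF_greatest)
    then have "1 \<le> real (Suc n) * infdist x K"
      using mult_mono[of 1 "real (Suc n)" 1 "infdist x K"] by simp
    then show ?thesis by (simp add: \<psi>_def)
  qed
  have lim: "(\<lambda>n. \<psi> n x) \<longlonglongrightarrow> indicator K x" for x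
  proof (cases "x \<in> K")
    case True
    then show ?thesis by (simp add: \<psi>_def)
  next
    case x: False
    then have pos: "infdist x K > 0"
      using infdist_pos_not_in_closed[OF compact_imp_closed[OF K] False] by blast
    obtain N where N: "1 / infdist x K \<le> real N" using real_arch_simple by blast
    have "eventually (\<lambda>n. \<psi> n x = 0) sequentially"
      using eventually_ge_at_top[of N]
    proof eventually_elim
      case (elim n)
      then have "1 / infdist x K \<le> real (Suc n)" using N by linarith
      then have "1 \<le> real (Suc n) * infdist x K" using pos by (simp add: field_simps)
      then show ?case by (simp add: \<psi>_def)
    qed
    then show ?thesis using x by (simp add: tendsto_eventually)
  qed
  have le: "norm (LINT y|lborel. f y * complex_of_real (\<psi> n y)) \<le> B * (LINT x|lborel. \<psi> n x)" for n
    by (rule norm_integral_mult_continuous_le[OF f B cont range supp]) (auto simp: m_def)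
  have \<psi>_le: "\<psi> n x \<le> indicator {-m..m} x" for n x
    using range[of n x] supp[of x n] by (auto simp: indicator_def abs_less_iff)
  have int_ind: "integrable lborel (indicator {-m..m} :: real \<Rightarrow> real)"
    by (rule integrable_real_indicator) (auto simp: emeasure_lborel_Icc_eq)
  have "(\<lambda>n. LINT y|lborel. \<psi> n y) \<longlonglongrightarrow> (LINT y|lborel. indicator K y)"
    by (rule integral_dominated_convergence[OF _ _ int_ind]) (use lim \<psi>_le range in auto)
  then have 1: "(\<lambda>n. B * (LINT y|lborel. \<psi> n y)) \<longlonglongrightarrow> B * measure lborel K"
    by (intro tendsto_intros) simp
  have int_dom: "integrable lborel (\<lambda>y. norm (indicator {-m..m} y *\<^sub>R f y))"
    by (intro integrable_norm L2_restrict_integrable f)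
  have "(\<lambda>n. LINT y|lborel. f y * complex_of_real (\<psi> n y)) \<longlonglongrightarrow> (LINT y|lborel. f y * complex_of_real (indicator K y))"
  proof (rule integral_dominated_convergence[OF _ _ int_dom])
    show "AE y in lborel. (\<lambda>n. f y * complex_of_real (\<psi> n y)) \<longlonglongrightarrow> f y * complex_of_real (indicator K y)"
      by (intro AE_I2 tendsto_intros lim)
    show "AE y in lborel. norm (f y * complex_of_real (\<psi> n y)) \<le> norm (indicator {-m..m} y *\<^sub>R f y)" for n
    proof (rule AE_I2)
      show "norm (f y * complex_of_real (\<psi> n y)) \<le> norm (indicator {-m..m} y *\<^sub>R f y)" for y
        using mult_left_mono[OF \<psi>_le[of n y], of "norm (f y)"] range[of n y]
        by (simp add: norm_mult mult.commute)
    qed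
  qed auto
  then have "(\<lambda>n. norm (LINT y|lborel. f y * complex_of_real (\<psi> n y))) \<longlonglongrightarrow> norm (LINT y|lborel. f y * complex_of_real (indicator K y))"
    by (rule tendsto_norm)
  from LIMSEQ_le[OF this 1] show ?thesis using le by blast
qed simp

section \<open>The pointwise bound by the transform\<close>

text \<open>On a compact set where \<open>Re f\<close> exceeds \<open>B\<close>, the integral bound
  leaves room only for measure zero. By inner regularity the whole set where \<open>Re f\<close>
  exceeds \<open>B\<close> is then null.\<close>

lemma AE_Re_le:
  assumes f: "f \<in> L2"
    and K: "\<And>K. compact K \<Longrightarrow> norm (LINT y|lborel. f y * complex_of_real (indicator K y)) \<le> B * measure lborel K"
  shows "AE x in lborel. Re (f x) \<le> B"
proof -
  have [measurable]: "f \<in> borel_measurable borel" using f by (simp add: L2_iff)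
  define E where "E = {x. B < Re (f x)}"
  have [measurable]: "E \<in> sets borel" unfolding E_def by measurable
  have compact_null: "emeasure lborel K = 0" if cpt: "compact K" and sub: "K \<subseteq> E" for K
  proof -
    have [measurable]: "K \<in> sets borel" using cpt by (rule borel_compact)
    obtain a where "\<forall>x\<in>K. \<bar>x\<bar> \<le> a"
      using compact_imp_bounded[OF cpt] by (auto simp: bounded_iff)
    then have a: "K \<subseteq> {-a..a}" by (auto simp: abs_le_iff)
    have int: "integrable lborel (\<lambda>y. f y * complex_of_real (indicator K y))"
    proof (rule Bochner_Integration.integrable_bound[OF L2_restrict_integrable[OF f, of "-a" a]])
      have "norm (f y * complex_of_real (indicator K y)) \<le> norm (indicator {-a..a} y *\<^sub>R f y)" for y
        using a by (cases "y \<in> K") auto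
      then show "AE y in lborel. norm (f y * complex_of_real (indicator K y)) \<le> norm (indicator {-a..a} y *\<^sub>R f y)"
        by simp
    qed simp
    have K_fin: "emeasure lborel K < \<infinity>"
      using emeasure_compact_finite[OF cpt] by simp
    then have int1: "integrable lborel (\<lambda>y. B * indicator K y)"
      by (intro integrable_mult_right integrable_real_indicator) auto
    have int2: "integrable lborel (\<lambda>y. Re (f y) * indicator K y)"
      using integrable_Re[OF int] by simp
    have "(LINT y|lborel. Re (f y) * indicator K y) = Re (LINT y|lborel. f y * complex_of_real (indicator K y))"
      using integral_Re[OF int] by simp
    also have "\<dots> \<le> B * measure lborel K"
      using complex_Re_le_cmod K[OF cpt] by (rule order_trans)
    finally have "(LINT y|lborel. (Re (f y) - B) * indicator K y) \<le> 0"
      using int1 int2 by (simp add: left_diff_distrib)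
    moreover have nonneg: "0 \<le> (Re (f y) - B) * indicator K y" for y
      using sub by (auto simp: E_def split: split_indicator)
    ultimately have "(LINT y|lborel. (Re (f y) - B) * indicator K y) = 0"
      by (intro antisym Bochner_Integration.integral_nonneg) auto
    then have "AE y in lborel. (Re (f y) - B) * indicator K y = 0"
      using int1 int2 nonneg by (subst (asm) integral_nonneg_eq_0_iff_AE) (auto simp: left_diff_distrib)
    then have "AE y in lborel. y \<notin> K"
    proof eventually_elim
      case (elim y)
      then show ?case using sub by (auto simp: E_def)
    qed
    then show ?thesis
      by (subst (asm) AE_iff_measurable[of K]) auto
  qed
  \<comment> \<open>\<open>E\<close> itself might have infinite measure; its bounded pieces do not,
    and their closed subsets are compact.\<close>
  have "emeasure lborel (E \<inter> {-real n..real n}) = 0" for n :: nat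
  proof (rule ccontr)
    assume pos: "emeasure lborel (E \<inter> {-real n..real n}) \<noteq> 0"
    let ?S = "E \<inter> {-real n..real n}"
    have fin: "emeasure lborel ?S < \<infinity>"
      by (rule le_less_trans[OF emeasure_mono[of _ "{-real n..real n}"]]) (auto simp: emeasure_lborel_Icc_eq)
    obtain e where e: "emeasure lborel ?S = ennreal e" "e > 0"
    proof (cases "emeasure lborel ?S" rule: ennreal_cases)
      case (real e)
      then show ?thesis using pos that[of e] by (cases "e = 0") simp_all
    next
      case top
      then show ?thesis using fin by simp
    qed
    have "?S \<in> sets lebesgue" by auto
    \<comment> \<open>The tolerance \<open>e\<close> is the full measure of \<open>?S\<close>, so a
      null \<open>T\<close> would leave a remainder of measure \<open>e\<close>, too large.\<close>
    then obtain T where T: "closed T" "T \<subseteq> ?S" "emeasure lebesgue (?S - T) < ennreal e"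
      using sets_lebesgue_inner_closed[of ?S e] e by metis
    have [measurable]: "T \<in> sets borel" using T(1) by (rule borel_closed)
    have "bounded T" using T(2) by (rule bounded_subset[rotated]) (rule bounded_subset[of "{-real n..real n}"], auto)
    then have "compact T" using T(1) by (simp add: compact_eq_bounded_closed)
    then have "emeasure lborel T = 0" using T(2) by (intro compact_null) auto
    then have "emeasure lborel ?S \<le> emeasure lborel (?S - T)"
      using emeasure_subadditive[of "?S - T" lborel T] T(2) by (simp add: Un_absorb2)
    moreover have "emeasure lborel (?S - T) < ennreal e"
      using T(3) by simp
    ultimately show False using e by simp
  qed
  then have "emeasure lborel (\<Union>n::nat. E \<inter> {-real n..real n}) = 0"
    by (intro emeasure_UN_eq_0) auto
  moreover have "(\<Union>n::nat. E \<inter> {-real n..real n}) = E"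
  proof -
    have "\<exists>n::nat. - real n \<le> x \<and> x \<le> real n" for x
      using real_arch_simple[of "\<bar>x\<bar>"] by (auto simp: abs_le_iff intro: minus_le_iff[THEN iffD1])
    then show ?thesis by auto
  qed
  ultimately have "emeasure lborel E = 0" by simp
  then show ?thesis
    by (subst AE_iff_measurable[of E]) (auto simp: E_def not_le)
qed

text \<open>Rotating \<open>f\<close> by \<open>1\<close>, \<open>-1\<close>, \<open>\<i>\<close>
  and \<open>-\<i>\<close> bounds \<open>\<bar>Re (f x)\<bar>\<close> and
  \<open>\<bar>Im (f x)\<bar>\<close> by the same constant; their sum accounts for the factor
  2.\<close>

lemma AE_norm_le_L1_fourier:
  assumes f: "f \<in> L2" and fg: "has_fourier_transform f g" and g: "integrable lborel g"
  shows "AE x in lborel. norm (f x) \<le> 2 * ((LINT \<xi>|lborel. norm (g \<xi>)) / sqrt (2 * pi))"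
proof -
  define B where "B = (LINT \<xi>|lborel. norm (g \<xi>)) / sqrt (2 * pi)"
  have *: "AE x in lborel. Re (u * f x) \<le> B" if u: "norm u = 1" for u
  proof (rule AE_Re_le)
    show "(\<lambda>x. u * f x) \<in> L2" using f u by (auto simp: L2_iff norm_mult)
    fix K :: "real set" assume "compact K"
    then have "norm (LINT y|lborel. f y * complex_of_real (indicator K y)) \<le> B * measure lborel K"
      unfolding B_def by (intro norm_integral_compact_le f norm_gaussian_average_le[OF f fg g])
    then show "norm (LINT y|lborel. u * f y * complex_of_real (indicator K y)) \<le> B * measure lborel K"
      using u by (simp add: mult.assoc norm_mult)
  qed
  have "AE x in lborel. norm (f x) \<le> 2 * B"
    using *[of 1, simplified] *[of "-1", simplified] *[of "\<i>", simplified] *[of "-\<i>", simplified]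
  proof eventually_elim
    case (elim x)
    then have "\<bar>Re (f x)\<bar> \<le> B" "\<bar>Im (f x)\<bar> \<le> B" by auto
    then show ?case using cmod_le[of "f x"] by linarith
  qed
  then show ?thesis by (simp add: B_def)
qed

section \<open>Uniqueness of the transform and the embedding\<close>

text \<open>Both functions are mean-square limits of the same cutoffs. This is needed because
  \<open>fourier\<close> picks some transform, while membership in \<open>Hs\<close> only says that
  one of them has a finite weighted norm.\<close>

lemma has_fourier_transform_unique:
  assumes "f \<in> L2" "has_fourier_transform f g" "has_fourier_transform f h"
  shows "AE \<xi> in lborel. g \<xi> = h \<xi>"
proof -
  have [measurable]: "f \<in> borel_measurable borel" "g \<in> borel_measurable borel" "h \<in> borel_measurable borel"
    using assms by (auto simp: L2_iff has_fourier_transform_def)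
  have F [measurable]: "fourier_cutoff f r \<in> borel_measurable borel" for r
    unfolding fourier_cutoff_def set_lebesgue_integral_def by measurable
  have le: "L2_sq lborel (\<lambda>\<xi>. g \<xi> - h \<xi>)
    \<le> 2 * L2_sq lborel (\<lambda>\<xi>. fourier_cutoff f r \<xi> - g \<xi>) + 2 * L2_sq lborel (\<lambda>\<xi>. fourier_cutoff f r \<xi> - h \<xi>)" for r
  proof -
    have pt: "(norm (a - b))\<^sup>2 \<le> 2 * (norm (c - a))\<^sup>2 + 2 * (norm (c - b))\<^sup>2" for a b c :: complex
    proof -
      have "norm (a - b) \<le> norm (c - a) + norm (c - b)"
        by (metis dist_commute dist_norm dist_triangle)
      then have "(norm (a - b))\<^sup>2 \<le> (norm (c - a) + norm (c - b))\<^sup>2"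
        by (intro power_mono) auto
      also have "\<dots> \<le> 2 * (norm (c - a))\<^sup>2 + 2 * (norm (c - b))\<^sup>2"
        using sum_squares_bound[of "norm (c - a)" "norm (c - b)"] by (simp add: power2_sum)
      finally show ?thesis .
    qed
    have "L2_sq lborel (\<lambda>\<xi>. g \<xi> - h \<xi>) \<le> (\<integral>\<^sup>+ \<xi>. 2 * ennreal ((norm (fourier_cutoff f r \<xi> - g \<xi>))\<^sup>2)
        + 2 * ennreal ((norm (fourier_cutoff f r \<xi> - h \<xi>))\<^sup>2) \<partial>lborel)"
      unfolding L2_sq_def
    proof (intro nn_integral_mono)
      fix \<xi>
      show "ennreal ((norm (g \<xi> - h \<xi>))\<^sup>2) \<le> 2 * ennreal ((norm (fourier_cutoff f r \<xi> - g \<xi>))\<^sup>2)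
        + 2 * ennreal ((norm (fourier_cutoff f r \<xi> - h \<xi>))\<^sup>2)"
        using ennreal_leI[OF pt[of "g \<xi>" "h \<xi>" "fourier_cutoff f r \<xi>"]] by (simp add: ennreal_mult)
    qed
    also have "\<dots> = 2 * L2_sq lborel (\<lambda>\<xi>. fourier_cutoff f r \<xi> - g \<xi>) + 2 * L2_sq lborel (\<lambda>\<xi>. fourier_cutoff f r \<xi> - h \<xi>)"
      unfolding L2_sq_def by (simp add: nn_integral_add nn_integral_cmult)
    finally show ?thesis .
  qed
  have "((\<lambda>r. 2 * L2_sq lborel (\<lambda>\<xi>. fourier_cutoff f r \<xi> - g \<xi>) + 2 * L2_sq lborel (\<lambda>\<xi>. fourier_cutoff f r \<xi> - h \<xi>))
     \<longlongrightarrow> 2 * 0 + 2 * 0) at_top"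
    using assms(2,3) unfolding has_fourier_transform_def
    by (intro tendsto_add ennreal_tendsto_cmult) auto
  from tendsto_lowerbound[OF this always_eventually[OF allI[OF le]]]
  have "L2_sq lborel (\<lambda>\<xi>. g \<xi> - h \<xi>) = 0" by simp
  then show ?thesis
    unfolding L2_sq_def by (subst (asm) nn_integral_0_iff_AE) auto
qed

text \<open>Cauchy-Schwarz for the factors \<open>(1 + x\<^sup>2) powr (s / 2) * norm (g x)\<close>
  and \<open>(1 + x\<^sup>2) powr (- s / 2)\<close> bounds the integral of \<open>norm (g x)\<close>
  by the Sobolev norm, as the second factor is square-integrable for
  \<open>s > 1 / 2\<close>.\<close>

lemma sobolev_embedding:
  assumes "s > 1 / 2"
  shows "\<exists>C>0. \<forall>f\<in>Hs s. AE x in lborel. norm (f x) \<le> C * Hs_norm s f"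
proof -
  define J where "J = enn2real (\<integral>\<^sup>+ x. ennreal ((1 + x\<^sup>2) powr - s) \<partial>lborel)"
  have J: "(\<integral>\<^sup>+ x. ennreal ((1 + x\<^sup>2) powr - s) \<partial>lborel) = ennreal J"
    using nn_integral_weight_finite[OF assms] by (simp add: J_def less_top)
  have "J \<ge> 0" by (simp add: J_def)
  \<comment> \<open>The summand 1 makes \<open>C\<close> positive from \<open>J \<ge> 0\<close>
    alone.\<close>
  define C where "C = 2 * (sqrt J / sqrt (2 * pi)) + 1"
  have C: "C > 0" "2 * (sqrt J / sqrt (2 * pi)) \<le> C"
    using \<open>J \<ge> 0\<close> by (auto simp: C_def add_nonneg_pos)
  have "AE x in lborel. norm (f x) \<le> C * Hs_norm s f" if f: "f \<in> Hs s" for f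
  proof -
    define g where "g = fourier f"
    have f_L2: "f \<in> L2" using f by (simp add: Hs_def)
    obtain h where h: "has_fourier_transform f h" "sobolev_weighted_sq s h < \<infinity>"
      using f by (auto simp: Hs_def)
    have g: "has_fourier_transform f g"
      using someI[of "has_fourier_transform f" h] h(1) by (simp add: g_def fourier_def)
    have [measurable]: "g \<in> borel_measurable borel"
      using g by (auto simp: has_fourier_transform_def L2_def)
    \<comment> \<open>Finiteness passes from the witness \<open>h\<close> to the chosen
      \<open>g\<close>. It matters because \<open>enn2real\<close> in \<open>Hs_norm\<close> would
      send an infinite value to 0.\<close>
    have "sobolev_weighted_sq s g = sobolev_weighted_sq s h"
      unfolding sobolev_weighted_sq_def
    proof (rule nn_integral_cong_AE)
      show "AE x in lborel. ennreal ((1 + x\<^sup>2) powr s * (norm (g x))\<^sup>2) = ennreal ((1 + x\<^sup>2) powr s * (norm (h x))\<^sup>2)"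
        using has_fourier_transform_unique[OF f_L2 g h(1)] by eventually_elim simp
    qed
    then have W: "sobolev_weighted_sq s g = ennreal ((Hs_norm s f)\<^sup>2)"
      using h(2) by (simp add: Hs_norm_def g_def less_top)
    have Hs_nonneg: "0 \<le> Hs_norm s f" by (simp add: Hs_norm_def)
    have pos: "0 < 1 + x\<^sup>2" for x :: real by (simp add: add_pos_nonneg)
    have sq: "((1 + x\<^sup>2) powr a)\<^sup>2 = (1 + x\<^sup>2) powr (2 * a)" for x a :: real
      by (simp add: power2_eq_square flip: powr_add)
    have split: "norm (g x) = ((1 + x\<^sup>2) powr (s / 2) * norm (g x)) * (1 + x\<^sup>2) powr (- s / 2)" for x
      using pos[of x] by (simp add: mult_ac flip: powr_add mult.assoc)
    have "(\<integral>\<^sup>+ x. ennreal (norm (g x)) \<partial>lborel)\<^sup>2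
      = (\<integral>\<^sup>+ x. ennreal ((1 + x\<^sup>2) powr (s / 2) * norm (g x)) * ennreal ((1 + x\<^sup>2) powr (- s / 2)) \<partial>lborel)\<^sup>2"
      by (subst split) (simp add: ennreal_mult)
    also have "\<dots> \<le> (\<integral>\<^sup>+ x. ennreal ((1 + x\<^sup>2) powr (s / 2) * norm (g x))^2 \<partial>lborel)
        * (\<integral>\<^sup>+ x. ennreal ((1 + x\<^sup>2) powr (- s / 2))^2 \<partial>lborel)"
      by (rule Cauchy_Schwarz_nn_integral) auto
    also have "(\<integral>\<^sup>+ x. ennreal ((1 + x\<^sup>2) powr (s / 2) * norm (g x))^2 \<partial>lborel) = sobolev_weighted_sq s g"
      unfolding sobolev_weighted_sq_def
      by (intro nn_integral_cong)
        (simp add: ennreal_power power_mult_distrib sq)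
    also have "(\<integral>\<^sup>+ x. ennreal ((1 + x\<^sup>2) powr (- s / 2))^2 \<partial>lborel) = ennreal J"
      unfolding J[symmetric]
      by (intro nn_integral_cong) (simp add: ennreal_power sq)
    also have "sobolev_weighted_sq s g * ennreal J = (ennreal (Hs_norm s f * sqrt J))\<^sup>2"
      using \<open>J \<ge> 0\<close> Hs_nonneg by (simp add: W ennreal_power power_mult_distrib flip: ennreal_mult)
    finally have *: "(\<integral>\<^sup>+ x. ennreal (norm (g x)) \<partial>lborel)\<^sup>2 \<le> (ennreal (Hs_norm s f * sqrt J))\<^sup>2" .
    have L1: "(\<integral>\<^sup>+ x. ennreal (norm (g x)) \<partial>lborel) \<le> ennreal (Hs_norm s f * sqrt J)"
    proof (cases "\<integral>\<^sup>+ x. ennreal (norm (g x)) \<partial>lborel" rule: ennreal_cases)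
      case (real r)
      moreover have "0 \<le> Hs_norm s f * sqrt J" using Hs_nonneg \<open>J \<ge> 0\<close> by simp
      ultimately show ?thesis
        using * unfolding real by (simp only: ennreal_power ennreal_le_iff zero_le_power power2_le_imp_le ennreal_leI)
    next
      case top
      moreover have "(top :: ennreal)\<^sup>2 = top"
        by (simp add: power2_eq_square ennreal_top_mult)
      ultimately have "top \<le> ennreal ((Hs_norm s f * sqrt J)\<^sup>2)"
        using * Hs_nonneg \<open>J \<ge> 0\<close> by (simp add: ennreal_power)
      then show ?thesis by (simp add: top_unique)
    qed
    then have int_g: "integrable lborel g"
      by (intro integrableI_bounded) (auto intro: le_less_trans)
    have "(LINT x|lborel. norm (g x)) \<le> Hs_norm s f * sqrt J"
      using L1 int_g Hs_nonneg \<open>J \<ge> 0\<close> by (simp add: nn_integral_eq_integral)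
    then have "2 * ((LINT x|lborel. norm (g x)) / sqrt (2 * pi)) \<le> 2 * (Hs_norm s f * sqrt J / sqrt (2 * pi))"
      by (intro mult_left_mono divide_right_mono) auto
    also have "\<dots> \<le> C * Hs_norm s f"
      using mult_right_mono[OF C(2) Hs_nonneg] by (simp add: mult_ac)
    finally have le: "2 * ((LINT x|lborel. norm (g x)) / sqrt (2 * pi)) \<le> C * Hs_norm s f" .
    show ?thesis
      using AE_norm_le_L1_fourier[OF f_L2 g int_g] by eventually_elim (rule order_trans[OF _ le])
  qed
  with C(1) show ?thesis by blast
qed

subsection \<open>Weighted norms\<close>

lemma L2_sq_mu_dot:
  assumes [measurable]: "f \<in> borel_measurable borel"
  shows "L2_sq (mu_dot \<theta>) f
    = (\<integral>\<^sup>+ \<xi>. ennreal (\<bar>\<xi>\<bar> powr (2 * \<theta>)) * ennreal ((norm (f \<xi>))\<^sup>2) \<partial>lborel)"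
  unfolding L2_sq_def mu_dot_def by (subst nn_integral_density) auto

text \<open>For \<open>\<bar>\<xi>\<bar> \<le> r\<close> the weight is at most
  \<open>r powr (2 * \<theta>)\<close>; beyond \<open>r\<close> the negative exponent
  \<open>2 * \<theta> - 2\<close> gives the second term. The radius stays free so that the first
  coefficient can be tuned.\<close>

lemma L2_sq_mu_dot_split:
  assumes [measurable]: "f \<in> borel_measurable borel" and "0 < \<theta>" "\<theta> < 1" "r > 0"
  shows "L2_sq (mu_dot \<theta>) f
    \<le> ennreal (r powr (2 * \<theta>)) * L2_sq lborel f
      + ennreal (r powr (2 * \<theta> - 2)) * L2_sq (mu_dot 1) f"
proof -
  have pt: "\<bar>\<xi>\<bar> powr (2 * \<theta>) \<le> r powr (2 * \<theta>) + r powr (2 * \<theta> - 2) * \<bar>\<xi>\<bar> powr 2" for \<xi>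
  proof (cases "\<bar>\<xi>\<bar> \<le> r")
    case True
    then have "\<bar>\<xi>\<bar> powr (2 * \<theta>) \<le> r powr (2 * \<theta>)"
      using assms by (intro powr_mono2) auto
    then show ?thesis by (simp add: add_increasing2)
  next
    case False
    have "\<bar>\<xi>\<bar> powr (2 * \<theta>) = \<bar>\<xi>\<bar> powr (2 * \<theta> - 2) * \<bar>\<xi>\<bar> powr 2"
      unfolding powr_add[symmetric] by simp
    also have "\<dots> \<le> r powr (2 * \<theta> - 2) * \<bar>\<xi>\<bar> powr 2"
      using False assms by (intro mult_right_mono powr_mono2') auto
    finally show ?thesis by (simp add: add_increasing)
  qed
  have "L2_sq (mu_dot \<theta>) f \<le> (\<integral>\<^sup>+ \<xi>. ennreal (r powr (2 * \<theta>)) * ennreal ((norm (f \<xi>))\<^sup>2)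
      + ennreal (r powr (2 * \<theta> - 2)) * (ennreal (\<bar>\<xi>\<bar> powr (2 * 1)) * ennreal ((norm (f \<xi>))\<^sup>2)) \<partial>lborel)"
    unfolding L2_sq_mu_dot[OF assms(1)]
  proof (intro nn_integral_mono)
    fix \<xi>
    have "ennreal (\<bar>\<xi>\<bar> powr (2 * \<theta>)) * ennreal ((norm (f \<xi>))\<^sup>2)
       \<le> ennreal (r powr (2 * \<theta>) + r powr (2 * \<theta> - 2) * \<bar>\<xi>\<bar> powr 2) * ennreal ((norm (f \<xi>))\<^sup>2)"
      by (intro mult_right_mono ennreal_leI pt) auto
    then show "ennreal (\<bar>\<xi>\<bar> powr (2 * \<theta>)) * ennreal ((norm (f \<xi>))\<^sup>2)
       \<le> ennreal (r powr (2 * \<theta>)) * ennreal ((norm (f \<xi>))\<^sup>2)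
      + ennreal (r powr (2 * \<theta> - 2)) * (ennreal (\<bar>\<xi>\<bar> powr (2 * 1)) * ennreal ((norm (f \<xi>))\<^sup>2))"
      by (simp add: ennreal_mult distrib_right mult.assoc)
  qed
  also have "\<dots> = ennreal (r powr (2 * \<theta>)) * L2_sq lborel f
      + ennreal (r powr (2 * \<theta> - 2)) * L2_sq (mu_dot 1) f"
    unfolding L2_sq_mu_dot[OF assms(1)] unfolding L2_sq_def
    by (simp add: nn_integral_add nn_integral_cmult)
  finally show ?thesis .
qed

text \<open>At least the fraction \<open>1 - \<gamma>\<close> of the integral comes from
  \<open>{-R<..<R}\<close>, where \<open>\<bar>\<xi>\<bar> powr 2 \<le> R powr (2 - 2 * \<theta>) *
  \<bar>\<xi>\<bar> powr (2 * \<theta>)\<close>.\<close>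

lemma L2_sq_mu_dot_1_le:
  assumes [measurable]: "f \<in> borel_measurable borel" and "\<theta> < 1" "R > 0" "0 < \<gamma>" "\<gamma> < 1"
    and fin: "L2_sq (mu_dot 1) f < \<infinity>"
    and tail: "(\<integral>\<^sup>+ \<xi>\<in>UNIV - {-R<..<R}. ennreal ((norm (f \<xi>))\<^sup>2) \<partial>(mu_dot 1))
            \<le> ennreal \<gamma> * L2_sq (mu_dot 1) f"
  shows "L2_sq (mu_dot 1) f \<le> ennreal (R powr (2 - 2 * \<theta>) / (1 - \<gamma>)) * L2_sq (mu_dot \<theta>) f"
proof -
  let ?X = "L2_sq (mu_dot 1) f"
  let ?P = "\<integral>\<^sup>+ \<xi>\<in>{-R<..<R}. ennreal ((norm (f \<xi>))\<^sup>2) \<partial>(mu_dot 1)"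
  let ?Q = "\<integral>\<^sup>+ \<xi>\<in>UNIV - {-R<..<R}. ennreal ((norm (f \<xi>))\<^sup>2) \<partial>(mu_dot 1)"
  have sets: "sets (mu_dot 1) = sets borel" by (simp add: mu_dot_def)
  have m: "g \<in> borel_measurable (mu_dot 1)" if "g \<in> borel_measurable borel" for g :: "real \<Rightarrow> ennreal"
    using that by (simp add: measurable_cong_sets[OF sets refl])
  have "?X = (\<integral>\<^sup>+ \<xi>. ennreal ((norm (f \<xi>))\<^sup>2) * indicator {-R<..<R} \<xi>
      + ennreal ((norm (f \<xi>))\<^sup>2) * indicator (UNIV - {-R<..<R}) \<xi> \<partial>(mu_dot 1))"
    unfolding L2_sq_def by (intro nn_integral_cong) (auto split: split_indicator)
  also have "\<dots> = ?P + ?Q"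
    by (intro nn_integral_add m) auto
  finally have X: "?X = ?P + ?Q" .
  have P: "?P \<le> ennreal (R powr (2 - 2 * \<theta>)) * L2_sq (mu_dot \<theta>) f"
  proof -
    have pt: "\<bar>\<xi>\<bar> powr 2 \<le> R powr (2 - 2 * \<theta>) * \<bar>\<xi>\<bar> powr (2 * \<theta>)" if "\<bar>\<xi>\<bar> < R" for \<xi>
    proof -
      have "\<bar>\<xi>\<bar> powr 2 = \<bar>\<xi>\<bar> powr (2 - 2 * \<theta>) * \<bar>\<xi>\<bar> powr (2 * \<theta>)"
        by (simp flip: powr_add)
      also have "\<dots> \<le> R powr (2 - 2 * \<theta>) * \<bar>\<xi>\<bar> powr (2 * \<theta>)"
        using that assms by (intro mult_right_mono powr_mono2) auto
      finally show ?thesis .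
    qed
    have "?P = (\<integral>\<^sup>+ \<xi>. ennreal (\<bar>\<xi>\<bar> powr (2 * 1)) * (ennreal ((norm (f \<xi>))\<^sup>2) * indicator {-R<..<R} \<xi>) \<partial>lborel)"
      unfolding mu_dot_def by (subst nn_integral_density) auto
    also have "\<dots> \<le> (\<integral>\<^sup>+ \<xi>. ennreal (R powr (2 - 2 * \<theta>)) * (ennreal (\<bar>\<xi>\<bar> powr (2 * \<theta>)) * ennreal ((norm (f \<xi>))\<^sup>2)) \<partial>lborel)"
    proof (intro nn_integral_mono)
      fix \<xi> :: real
      show "ennreal (\<bar>\<xi>\<bar> powr (2 * 1)) * (ennreal ((norm (f \<xi>))\<^sup>2) * indicator {-R<..<R} \<xi>)
        \<le> ennreal (R powr (2 - 2 * \<theta>)) * (ennreal (\<bar>\<xi>\<bar> powr (2 * \<theta>)) * ennreal ((norm (f \<xi>))\<^sup>2))"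
      proof (cases "\<bar>\<xi>\<bar> < R")
        case True
        then show ?thesis
          using mult_right_mono[OF ennreal_leI[OF pt[OF True]], of "ennreal ((norm (f \<xi>))\<^sup>2)"]
          by (auto simp: ennreal_mult mult.assoc abs_less_iff split: split_indicator)
      next
        case False
        then show ?thesis by (auto simp: abs_less_iff split: split_indicator)
      qed
    qed
    also have "\<dots> = ennreal (R powr (2 - 2 * \<theta>)) * L2_sq (mu_dot \<theta>) f"
      unfolding L2_sq_mu_dot[OF assms(1)] by (simp add: nn_integral_cmult)
    finally show ?thesis .
  qed
  \<comment> \<open>The tail is absorbed into the left-hand side by subtraction, so the argument
    moves to real numbers, which \<open>fin\<close> permits.\<close>
  obtain x where x: "?X = ennreal x" "x \<ge> 0"
    using fin by (cases "L2_sq (mu_dot 1) f" rule: ennreal_cases) auto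
  have Pfin: "?P < \<infinity>" using X fin by (auto simp: less_top)
  obtain p where p: "?P = ennreal p" "p \<ge> 0"
    using Pfin by (cases ?P rule: ennreal_cases) auto
  have "ennreal x \<le> ennreal (p + \<gamma> * x)"
    using X tail x p assms by (simp add: ennreal_mult add_left_mono)
  then have "x \<le> p + \<gamma> * x"
    using x p assms by (subst (asm) ennreal_le_iff) auto
  then have "x \<le> p / (1 - \<gamma>)"
    using assms by (simp add: field_simps)
  then have "?X \<le> ennreal (1 / (1 - \<gamma>)) * ?P"
    using x p assms by (simp flip: ennreal_mult add: ennreal_leI)
  also have "\<dots> \<le> ennreal (1 / (1 - \<gamma>)) * (ennreal (R powr (2 - 2 * \<theta>)) * L2_sq (mu_dot \<theta>) f)"
    by (intro mult_left_mono P) auto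
  also have "\<dots> = ennreal (R powr (2 - 2 * \<theta>) / (1 - \<gamma>)) * L2_sq (mu_dot \<theta>) f"
    using assms by (simp flip: ennreal_mult mult.assoc)
  finally show ?thesis .
qed

section \<open>The choice of the exponent and the lower bound\<close>

text \<open>As \<open>\<rho>\<close> decreases to 0, the first right-hand side tends to
  \<open>e * c\<close>, strictly above \<open>d\<close>, while the other two grow like
  \<open>1 / \<rho>\<close> and pass any given \<open>k\<close> and \<open>l\<close>.\<close>

lemma ex_small_exponent:
  fixes a b c d e :: real
  assumes "a > 0" "b > 0" "c > 0" "d < e * c"
  shows "\<exists>\<rho>>0. d \<le> b powr (2 * \<rho>) * (e * c powr (\<rho> + 1))
    \<and> k \<le> b powr (2 * \<rho>) * (c powr \<rho> / \<rho>)
    \<and> l \<le> b powr (2 * \<rho>) * (1 / (\<rho> * a powr \<rho>))"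
proof -
  have "((\<lambda>\<rho>. b powr (2 * \<rho>) * (e * c powr (\<rho> + 1))) \<longlongrightarrow> b powr (2 * 0) * (e * c powr (0 + 1))) (at_right 0)"
    using assms by (intro tendsto_intros) auto
  then have "eventually (\<lambda>\<rho>. d < b powr (2 * \<rho>) * (e * c powr (\<rho> + 1))) (at_right 0)"
    using assms by (intro order_tendstoD(1)) auto
  moreover have "filterlim (\<lambda>\<rho>. b powr (2 * \<rho>) * (c powr \<rho> / \<rho>)) at_top (at_right 0)"
    using assms by real_asymp
  then have "eventually (\<lambda>\<rho>. k \<le> b powr (2 * \<rho>) * (c powr \<rho> / \<rho>)) (at_right 0)"
    by (simp add: filterlim_at_top)
  moreover have "filterlim (\<lambda>\<rho>. b powr (2 * \<rho>) * (1 / (\<rho> * a powr \<rho>))) at_top (at_right 0)"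
    using assms by real_asymp
  then have "eventually (\<lambda>\<rho>. l \<le> b powr (2 * \<rho>) * (1 / (\<rho> * a powr \<rho>))) (at_right 0)"
    by (simp add: filterlim_at_top)
  moreover have "eventually (\<lambda>\<rho>::real. \<rho> > 0) (at_right 0)"
    by (simp add: eventually_at_right_less)
  ultimately have "eventually (\<lambda>\<rho>. \<rho> > 0 \<and> d \<le> b powr (2 * \<rho>) * (e * c powr (\<rho> + 1))
    \<and> k \<le> b powr (2 * \<rho>) * (c powr \<rho> / \<rho>)
    \<and> l \<le> b powr (2 * \<rho>) * (1 / (\<rho> * a powr \<rho>))) (at_right 0)"
    by eventually_elim auto
  then show ?thesis
    using eventually_happens'[OF trivial_limit_at_right_real] by blast
qed

text \<open>Otherwise the sublevel set carries the whole integral, so \<open>level\<close> makes the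
  squared norm at most \<open>\<gamma>\<close> times itself. Being finite it is 0, against
  \<open>nz\<close>.\<close>

lemma not_AE_norm_less:
  assumes [measurable]: "f \<in> borel_measurable borel" and "\<gamma> < 1"
    and fin: "L2_sq lborel f < \<infinity>"
    and nz: "emeasure lborel {\<xi>. f \<xi> \<noteq> 0} > 0"
    and level: "(\<integral>\<^sup>+ \<xi>\<in>{\<xi>. (norm (f \<xi>))\<^sup>2 < c}. ennreal ((norm (f \<xi>))\<^sup>2) \<partial>(mu_dot 0))
       \<le> ennreal \<gamma> * L2_sq (mu_dot 0) f"
  shows "\<not> (AE \<xi> in lborel. (norm (f \<xi>))\<^sup>2 < c)"
proof
  assume AE: "AE \<xi> in lborel. (norm (f \<xi>))\<^sup>2 < c"
  \<comment> \<open>The density of \<open>mu_dot 0\<close> is 1 except at the point 0, where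
    \<open>0 powr 0 = 0\<close>.\<close>
  have mu0: "(\<integral>\<^sup>+ \<xi>. g \<xi> \<partial>(mu_dot 0)) = (\<integral>\<^sup>+ \<xi>. g \<xi> \<partial>lborel)"
    if [measurable]: "g \<in> borel_measurable borel" for g
  proof -
    have "(\<integral>\<^sup>+ \<xi>. g \<xi> \<partial>(mu_dot 0)) = (\<integral>\<^sup>+ \<xi>. ennreal (\<bar>\<xi>\<bar> powr (2 * 0)) * g \<xi> \<partial>lborel)"
      unfolding mu_dot_def by (rule nn_integral_density) auto
    also have "\<dots> = (\<integral>\<^sup>+ \<xi>. g \<xi> \<partial>lborel)"
    proof (intro nn_integral_cong_AE)
      show "AE \<xi> in lborel. ennreal (\<bar>\<xi>\<bar> powr (2 * 0)) * g \<xi> = g \<xi>"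
        using AE_lborel_singleton[of "0::real"] by eventually_elim simp
    qed
    finally show ?thesis .
  qed
  have L0: "L2_sq (mu_dot 0) f = L2_sq lborel f"
    unfolding L2_sq_def by (rule mu0) auto
  have "L2_sq lborel f = (\<integral>\<^sup>+ \<xi>\<in>{\<xi>. (norm (f \<xi>))\<^sup>2 < c}. ennreal ((norm (f \<xi>))\<^sup>2) \<partial>lborel)"
    unfolding L2_sq_def
  proof (intro nn_integral_cong_AE)
    show "AE \<xi> in lborel. ennreal ((norm (f \<xi>))\<^sup>2)
        = ennreal ((norm (f \<xi>))\<^sup>2) * indicator {\<xi>. (norm (f \<xi>))\<^sup>2 < c} \<xi>"
      using AE by eventually_elim simp
  qed
  also have "\<dots> = (\<integral>\<^sup>+ \<xi>\<in>{\<xi>. (norm (f \<xi>))\<^sup>2 < c}. ennreal ((norm (f \<xi>))\<^sup>2) \<partial>(mu_dot 0))"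
    by (rule mu0[symmetric]) auto
  finally have "L2_sq lborel f \<le> ennreal \<gamma> * L2_sq lborel f"
    using level L0 by simp
  moreover obtain x where x: "L2_sq lborel f = ennreal x" "x \<ge> 0"
    using fin by (cases "L2_sq lborel f" rule: ennreal_cases) auto
  ultimately have "ennreal x \<le> ennreal \<gamma> * ennreal x" by simp
  then have "x = 0"
  \<comment> \<open>For negative \<open>\<gamma>\<close> the value of
    \<open>ennreal \<gamma>\<close> is 0.\<close>
  proof (cases "\<gamma> \<ge> 0")
    case True
    with \<open>ennreal x \<le> ennreal \<gamma> * ennreal x\<close> x have "x \<le> \<gamma> * x" by (simp flip: ennreal_mult)
    moreover have "\<gamma> * x < 1 * x" if "x \<noteq> 0" using that x assms by (intro mult_strict_right_mono) auto
    ultimately show ?thesis by force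
  next
    case False
    with \<open>ennreal x \<le> ennreal \<gamma> * ennreal x\<close> x show ?thesis by (simp add: ennreal_neg)
  qed
  then have "L2_sq lborel f = 0" using x by simp
  then have "AE \<xi> in lborel. f \<xi> = 0"
    unfolding L2_sq_def by (subst (asm) nn_integral_0_iff_AE) auto
  then have "emeasure lborel {\<xi>. f \<xi> \<noteq> 0} = 0"
    by (subst (asm) AE_iff_measurable[OF _ refl]) auto
  with nz show False by simp
qed

text \<open>\<open>\<Theta>\<close> is a function because two of its values occur:
  \<open>\<Theta> \<theta>\<close> in the constants, and \<open>\<Theta> 0\<close> in the lower
  bound for the Sobolev norm. The exponent is chosen before \<open>t\<close> and
  \<open>f\<close>.\<close>

theorem lemma2p2:
  fixes T s C0 C0' C1' R \<gamma>2 :: real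
    and \<Theta> :: "real \<Rightarrow> real"
    and A :: "(real \<Rightarrow> real \<Rightarrow> complex) set"
  assumes "T > 0" and "s > 1/2"
    and A_Hs: "\<And>f t. f \<in> A \<Longrightarrow> t \<in> {-T..T} \<Longrightarrow> f t \<in> Hs s"
    and i: "\<And>f t. f \<in> A \<Longrightarrow> t \<in> {-T..T} \<Longrightarrow> emeasure lborel {\<xi>. f t \<xi> \<noteq> 0} > 0"
    and ii_const: "C0 > 0" "C0' > 0" "C1' \<ge> 0"
    and ii_fin: "\<And>f. f \<in> A \<Longrightarrow> L2_sq (mu_dot 1) (f 0) < \<infinity>"
    and ii_L2: "\<And>f t. f \<in> A \<Longrightarrow> t \<in> {-T..T} \<Longrightarrow>
          L2_sq lborel (f t) \<le> ennreal C0 * L2_sq lborel (f 0)"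
    and ii_mu: "\<And>f t. f \<in> A \<Longrightarrow> t \<in> {-T..T} \<Longrightarrow>
          L2_sq (mu_dot 1) (f t) \<le> ennreal C0' * L2_sq (mu_dot 1) (f 0) + ennreal C1'"
    and iii_const: "\<And>\<theta>. \<theta> \<in> {0..1} \<Longrightarrow> \<Theta> \<theta> > 0"
    and iii: "\<And>\<theta> f t. \<theta> \<in> {0..1} \<Longrightarrow> f \<in> A \<Longrightarrow> t \<in> {-T..T} \<Longrightarrow>
          \<exists>\<gamma>1\<in>{0<..<1}.
            (\<integral>\<^sup>+ \<xi>\<in>{\<xi>. (norm (f t \<xi>))\<^sup>2 < \<Theta> \<theta>}. ennreal ((norm (f t \<xi>))\<^sup>2) \<partial>(mu_dot \<theta>))
              \<le> ennreal \<gamma>1 * L2_sq (mu_dot \<theta>) (f t)"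
    and iv_const: "R > 0" "\<gamma>2 \<in> {0<..<1}"
    and iv: "\<And>f. f \<in> A \<Longrightarrow>
          (\<integral>\<^sup>+ \<xi>\<in>UNIV - {-R<..<R}. ennreal ((norm (f 0 \<xi>))\<^sup>2) \<partial>(mu_dot 1))
            \<le> ennreal \<gamma>2 * L2_sq (mu_dot 1) (f 0)"
  shows "\<forall>\<theta>\<in>{0<..<1}. \<exists>\<rho>>0. \<forall>t\<in>{-T..T}. \<forall>f\<in>A.
           (let K0 = C0 * R powr (2 * \<theta>) * (4 / \<Theta> \<theta>) powr (\<rho> + 1);
                K1 = C0' / (\<rho> * (1 - \<gamma>2)) * (4 / \<Theta> \<theta>) powr \<rho>;
                K2 = C1' / (\<rho> * R powr (2 * \<theta> * \<rho>))
            in L2_sq (mu_dot \<theta>) (f t)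
                 \<le> ennreal (Hs_norm s (f t) powr (2 * \<rho>)) *
                     (ennreal K0 * L2_sq lborel (f 0)
                      + ennreal K1 * L2_sq (mu_dot \<theta>) (f 0)
                      + ennreal K2))"
proof
  fix \<theta> :: real assume \<theta>: "\<theta> \<in> {0<..<1}"
  obtain C where C: "C > 0"
    and embed: "\<And>h. h \<in> Hs s \<Longrightarrow> AE x in lborel. norm (h x) \<le> C * Hs_norm s h"
    using sobolev_embedding[OF \<open>s > 1/2\<close>] by blast
  \<comment> \<open>Where \<open>(norm (f t \<xi>))\<^sup>2 \<ge> \<Theta> 0\<close>, the embedding
    gives \<open>sqrt (\<Theta> 0) \<le> C * Hs_norm s (f t)\<close>. The bound is the same for all
    \<open>f\<close> and \<open>t\<close>, hence so is the exponent.\<close>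
  define b where "b = sqrt (\<Theta> 0) / C"
  have "\<Theta> 0 > 0" "\<Theta> \<theta> > 0" using iii_const \<theta> by auto
  then have b: "b > 0" using C by (simp add: b_def)
  have lower: "b \<le> Hs_norm s (f t)" if f: "f \<in> A" and t: "t \<in> {-T..T}" for f t
  proof (rule ccontr)
    assume "\<not> b \<le> Hs_norm s (f t)"
    then have "C * Hs_norm s (f t) < sqrt (\<Theta> 0)"
      using C by (simp add: b_def field_simps)
    then have "(norm (f t \<xi>))\<^sup>2 < \<Theta> 0" if "norm (f t \<xi>) \<le> C * Hs_norm s (f t)" for \<xi>
      using that \<open>\<Theta> 0 > 0\<close> real_less_rsqrt real_sqrt_less_iff real_sqrt_abs abs_norm_cancel
      by (metis le_less_trans)
    then have "AE \<xi> in lborel. (norm (f t \<xi>))\<^sup>2 < \<Theta> 0"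
      using embed[OF A_Hs[OF f t]] by (rule eventually_mono[rotated])
    moreover have "f t \<in> L2" using A_Hs[OF f t] by (simp add: Hs_def)
    moreover obtain \<gamma>1 where "\<gamma>1 < 1"
      "(\<integral>\<^sup>+ \<xi>\<in>{\<xi>. (norm (f t \<xi>))\<^sup>2 < \<Theta> 0}. ennreal ((norm (f t \<xi>))\<^sup>2) \<partial>(mu_dot 0))
         \<le> ennreal \<gamma>1 * L2_sq (mu_dot 0) (f t)"
      using iii[of 0, OF _ f t] by auto
    ultimately show False
      using not_AE_norm_less[of "f t" \<gamma>1 "\<Theta> 0"] i[OF f t] by (simp add: L2_def)
  qed
  define e where "e = R powr (2 * \<theta>)"
  define c where "c = 4 / \<Theta> \<theta>"
  \<comment> \<open>\<open>d\<close> will be the coefficient of the \<open>L2\<close> norm in the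
    split. Half of \<open>e * c\<close>, the limit of the available coefficient, leaves the room
    required for small exponents. \<open>r\<close> is the radius with
    \<open>r powr (2 * \<theta>) = d\<close>, and \<open>l\<close> is the high-frequency coefficient
    it produces.\<close>
  define d where "d = e * c / 2"
  define r where "r = d powr (1 / (2 * \<theta>))"
  define l where "l = r powr (2 * \<theta> - 2)"
  have "e > 0" "c > 0"
    using \<open>\<Theta> \<theta> > 0\<close> iv_const by (auto simp: e_def c_def)
  then have pos: "e > 0" "c > 0" "d > 0" "r > 0" "d < e * c"
    by (auto simp: d_def r_def)
  have rd: "r powr (2 * \<theta>) = d"
    using \<theta> pos by (simp add: r_def powr_powr)
  \<comment> \<open>\<open>e\<close> takes the place of \<open>a\<close> as well, since
    \<open>e powr \<rho> = R powr (2 * \<theta> * \<rho>)\<close> is the power in the denominator of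
    \<open>K2\<close>. The three inequalities match \<open>K0\<close>, \<open>K1\<close> and
    \<open>K2\<close>, up to factors free of \<open>\<rho>\<close>.\<close>
  obtain \<rho> where \<rho>: "\<rho> > 0"
    and d: "d \<le> b powr (2 * \<rho>) * (e * c powr (\<rho> + 1))"
    and k: "l * R powr (2 - 2 * \<theta>) \<le> b powr (2 * \<rho>) * (c powr \<rho> / \<rho>)"
    and l: "l \<le> b powr (2 * \<rho>) * (1 / (\<rho> * e powr \<rho>))"
    using ex_small_exponent[of e b c d e "l * R powr (2 - 2 * \<theta>)" l] pos b by blast
  define K0 where "K0 = C0 * R powr (2 * \<theta>) * (4 / \<Theta> \<theta>) powr (\<rho> + 1)"
  define K1 where "K1 = C0' / (\<rho> * (1 - \<gamma>2)) * (4 / \<Theta> \<theta>) powr \<rho>"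
  define K2 where "K2 = C1' / (\<rho> * R powr (2 * \<theta> * \<rho>))"
  have "1 - \<gamma>2 > 0" using iv_const by simp
  have Kpos: "K0 \<ge> 0" "K1 \<ge> 0" "K2 \<ge> 0"
    using ii_const \<rho> \<open>1 - \<gamma>2 > 0\<close> by (auto simp: K0_def K1_def K2_def)
  have K0: "d * C0 \<le> b powr (2 * \<rho>) * K0"
    using mult_right_mono[OF d, of C0] ii_const by (simp add: K0_def e_def c_def mult_ac)
  have K1: "l * C0' * (R powr (2 - 2 * \<theta>) / (1 - \<gamma>2)) \<le> b powr (2 * \<rho>) * K1"
    using mult_right_mono[OF k, of "C0' / (1 - \<gamma>2)"] ii_const \<open>1 - \<gamma>2 > 0\<close>
    by (simp add: K1_def c_def mult_ac)
  have K2: "l * C1' \<le> b powr (2 * \<rho>) * K2"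
    using mult_right_mono[OF l, of C1'] ii_const by (simp add: K2_def e_def powr_powr mult_ac)
  have "L2_sq (mu_dot \<theta>) (f t) \<le> ennreal (Hs_norm s (f t) powr (2 * \<rho>)) *
      (ennreal K0 * L2_sq lborel (f 0) + ennreal K1 * L2_sq (mu_dot \<theta>) (f 0) + ennreal K2)"
    if f: "f \<in> A" and t: "t \<in> {-T..T}" for f t
  proof -
    let ?N = "L2_sq lborel (f 0)" and ?M = "L2_sq (mu_dot \<theta>) (f 0)"
    let ?h = "b powr (2 * \<rho>)"
    define q where "q = R powr (2 - 2 * \<theta>) / (1 - \<gamma>2)"
    have "q \<ge> 0" using \<open>1 - \<gamma>2 > 0\<close> by (simp add: q_def)
    have 0: "0 \<in> {-T..T}" using \<open>T > 0\<close> by simp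
    have meas: "f t \<in> borel_measurable borel" "f 0 \<in> borel_measurable borel"
      using A_Hs[OF f t] A_Hs[OF f 0] by (auto simp: Hs_def L2_def)
    have M: "L2_sq (mu_dot 1) (f 0) \<le> ennreal q * ?M"
      unfolding q_def using meas(2) \<theta> iv_const ii_fin[OF f] iv[OF f] by (intro L2_sq_mu_dot_1_le) auto
    have "L2_sq (mu_dot \<theta>) (f t) \<le> ennreal d * L2_sq lborel (f t) + ennreal l * L2_sq (mu_dot 1) (f t)"
      using L2_sq_mu_dot_split[OF meas(1), of \<theta> r] \<theta> pos by (simp add: rd l_def)
    \<comment> \<open>The norms at time \<open>t\<close> go back to time 0 by (ii), and (iv),
      through \<open>M\<close>, trades the weight of order 1 at time 0 for that of order
      \<open>\<theta>\<close>.\<close>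
    also have "\<dots> \<le> ennreal d * (ennreal C0 * ?N) + ennreal l *
        (ennreal C0' * (ennreal q * ?M) + ennreal C1')"
      by (intro add_mono mult_left_mono ii_L2[OF f t] order_trans[OF ii_mu[OF f t]] M) auto
    also have "\<dots> = ennreal (d * C0) * ?N
        + ennreal (l * C0' * q) * ?M + ennreal (l * C1')"
      using pos ii_const \<open>q \<ge> 0\<close>
      by (simp add: ennreal_mult l_def distrib_left mult.assoc add.assoc)
    also have "\<dots> \<le> ennreal (?h * K0) * ?N + ennreal (?h * K1) * ?M + ennreal (?h * K2)"
      by (intro add_mono mult_right_mono ennreal_leI K0 K1[folded q_def] K2) auto
    also have "\<dots> = ennreal ?h * (ennreal K0 * ?N + ennreal K1 * ?M + ennreal K2)"
      using Kpos by (simp add: ennreal_mult distrib_left mult.assoc)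
    \<comment> \<open>As \<open>2 * \<rho>\<close> is positive, the lower bound \<open>b\<close> for
      the Sobolev norm survives the power.\<close>
    also have "\<dots> \<le> ennreal (Hs_norm s (f t) powr (2 * \<rho>)) *
        (ennreal K0 * ?N + ennreal K1 * ?M + ennreal K2)"
      using b \<rho> by (intro mult_right_mono ennreal_leI powr_mono2 lower[OF f t]) auto
    finally show ?thesis .
  qed
  then show "\<exists>\<rho>>0. \<forall>t\<in>{-T..T}. \<forall>f\<in>A.
           (let K0 = C0 * R powr (2 * \<theta>) * (4 / \<Theta> \<theta>) powr (\<rho> + 1);
                K1 = C0' / (\<rho> * (1 - \<gamma>2)) * (4 / \<Theta> \<theta>) powr \<rho>;
                K2 = C1' / (\<rho> * R powr (2 * \<theta> * \<rho>))
            in L2_sq (mu_dot \<theta>) (f t)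
                 \<le> ennreal (Hs_norm s (f t) powr (2 * \<rho>)) *
                     (ennreal K0 * L2_sq lborel (f 0)
                      + ennreal K1 * L2_sq (mu_dot \<theta>) (f 0)
                      + ennreal K2))"
    using \<rho> unfolding K0_def K1_def K2_def Let_def by blast
qed

end
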